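(* Let $L$ be an integral positive definite lattice and let $\varphi$ be a holomorphic Jacobi form of singular weight $\frac12\mathrm{rk}(L)$ (with some character $v_\eta^D$) and index $L$. Let $v\in L'$ be nonzero and suppose $\varphi$ vanishes identically on $v^\perp:=\{(\tau,\mathfrak z)\in\mathbb H\times(L\otimes\mathbb C): (v,\mathfrak z)=0\}$. Then $v^\perp$ occurs with multiplicity exactly one in the divisor of $\varphi$, and $\varphi(\tau,\sigma_v(\mathfrak z))=-\varphi(\tau,\mathfrak z)$ for all $(\tau,\mathfrak z)\in\mathbb H\times(L\otimes\mathbb C)$, where $\sigma_v(x)=x-\frac{2(v,x)}{(v,v)}v$ is the reflection fixing $v^\perp$ (extended $\mathbb C$-linearly).
   Context: Let $L$ be an integral positive definite lattice with bilinear form $(-,-)$ (extended $\mathbb C$-bilinearly), dual lattice $L'$ and rank $\mathrm{rk}(L)$. Notation: $\mathbb H$ is the upper half-plane, $q=e^{2\pi i\tau}$, $\zeta^\ell=e^{2\pi i(\ell,\mathfrak z)}$; $v_\eta$ is the multiplier system of the Dedekind eta function $\eta(\tau)=q^{1/24}\prod_{n\ge1}(1-q^n)$ on $\mathrm{SL}_2(\mathbb Z)$ (weight $1/2$). The shadow of $L$ is $L^\bullet=\{x\in L\otimes\mathbb Q: (x,y)-(y,y)/2\in\mathbb Z\ \forall y\in L\}$. A holomorphic Jacobi form of weight $k$ (integral or half-integral), character $v_\eta^D$ ($D\in\mathbb Z/24$) and index $L$ is a holomorphic $\varphi:\mathbb H\times(L\otimes\mathbb C)\to\mathbb C$ with $\varphi\big(\frac{a\tau+b}{c\tau+d},\frac{\mathfrak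 z}{c\tau+d}\big)=v_\eta(A)^D(c\tau+d)^k\exp\big(\pi i\frac{c(\mathfrak z,\mathfrak z)}{c\tau+d}\big)\varphi(\tau,\mathfrak z)$ for all $A=\begin{psmallmatrix}a&b\\c&d\end{psmallmatrix}\in\mathrm{SL}_2(\mathbb Z)$, $\varphi(\tau,\mathfrak z+x\tau+y)=(-1)^{(x,x)+(y,y)}\exp(-\pi i((x,x)\tau+2(x,\mathfrak z)))\varphi(\tau,\mathfrak z)$ for all $x,y\in L$, and with Fourier expansion $\varphi=\sum f(n,\ell)q^n\zeta^\ell$ over $n\in\frac{D}{24}+\mathbb Z$, $\ell\in L^\bullet$ with $2n\ge(\ell,\ell)$. The weight $\frac12\mathrm{rk}(L)$ is called singular. *)

theory Defs
  imports "HOL-Complex_Analysis.Complex_Analysis"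
begin

text \<open>A lattice L of rank CARD('n) is modelled as int^'n with an integer Gram matrix G,
  so (x,y) = x^T G y; L tensor C is complex^'n, L tensor R is real^'n.\<close>

definition bf :: "int^'n^'n \<Rightarrow> 'a::comm_ring_1^'n \<Rightarrow> 'a^'n \<Rightarrow> 'a" where
  "bf G x y = (\<Sum>i\<in>UNIV. \<Sum>j\<in>UNIV. x$i * of_int (G$i$j) * y$j)"

definition int_pos_def_lattice :: "int^'n^'n \<Rightarrow> bool" where
  "int_pos_def_lattice G \<longleftrightarrow> (\<forall>i j. G$i$j = G$j$i) \<and>
     (\<forall>x::real^'n. x \<noteq> 0 \<longrightarrow> bf G x x > 0)"

definition ivec :: "int^'n \<Rightarrow> 'a::comm_ring_1^'n" where
  "ivec x = (\<chi> i. of_int (x$i))"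

definition rvec :: "real^'n \<Rightarrow> complex^'n" where
  "rvec x = (\<chi> i. complex_of_real (x$i))"

definition dual_lattice :: "int^'n^'n \<Rightarrow> (real^'n) set" where
  "dual_lattice G = {x. \<forall>y::int^'n. bf G x (ivec y) \<in> \<int>}"

definition shadow :: "int^'n^'n \<Rightarrow> (real^'n) set" where
  "shadow G = {x. \<forall>y::int^'n. bf G x (ivec y) - bf G (ivec y) (ivec y) / 2 \<in> \<int>}"

definition upper_half_plane :: "complex set" where
  "upper_half_plane = {\<tau>. Im \<tau> > 0}"

definition dedekind_eta :: "complex \<Rightarrow> complex" where
  "dedekind_eta \<tau> = exp (2 * pi * \<i> * \<tau> / 24) *
      (\<Prod>n. (1 - exp (2 * pi * \<i> * of_nat (Suc n) * \<tau>)))"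

definition v_eta :: "int \<Rightarrow> int \<Rightarrow> int \<Rightarrow> int \<Rightarrow> complex" where
  "v_eta a b c d = (THE e. \<forall>\<tau>\<in>upper_half_plane.
      dedekind_eta ((of_int a * \<tau> + of_int b) / (of_int c * \<tau> + of_int d)) =
      e * csqrt (of_int c * \<tau> + of_int d) * dedekind_eta \<tau>)"

text \<open>Holomorphy on H x C^n, via separate holomorphy (equivalent by Hartogs).\<close>
definition holo_HC :: "(complex \<Rightarrow> complex^'n \<Rightarrow> complex) \<Rightarrow> bool" where
  "holo_HC \<phi> \<longleftrightarrow> (\<forall>z. (\<lambda>t. \<phi> t z) holomorphic_on upper_half_plane) \<and>
     (\<forall>\<tau>\<in>upper_half_plane. \<forall>z i.
        (\<lambda>w. \<phi> \<tau> (\<chi> j. if j = i then w else z$j)) holomorphic_on UNIV)"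

definition fourier_index :: "int^'n^'n \<Rightarrow> int \<Rightarrow> (real \<times> (real^'n)) set" where
  "fourier_index G D = {(m, l). m - of_int D / 24 \<in> \<int> \<and> l \<in> shadow G \<and> 2 * m \<ge> bf G l l}"

text \<open>Holomorphic Jacobi form of singular weight rk(L)/2, character v_eta^D, index L.
  (c tau + d)^(rk/2) is taken as csqrt(c tau + d)^rk, consistent with the eta convention.\<close>
definition singular_jacobi_form :: "int^'n^'n \<Rightarrow> int \<Rightarrow> (complex \<Rightarrow> complex^'n \<Rightarrow> complex) \<Rightarrow> bool" where
  "singular_jacobi_form G D \<phi> \<longleftrightarrow>
     holo_HC \<phi> \<and>
     (\<forall>a b c d. a * d - b * c = 1 \<longrightarrow> (\<forall>\<tau>\<in>upper_half_plane. \<forall>z.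
        \<phi> ((of_int a * \<tau> + of_int b) / (of_int c * \<tau> + of_int d))
          (\<chi> i. z$i / (of_int c * \<tau> + of_int d)) =
        v_eta a b c d powi D * csqrt (of_int c * \<tau> + of_int d) ^ CARD('n) *
        exp (pi * \<i> * of_int c * bf G z z / (of_int c * \<tau> + of_int d)) * \<phi> \<tau> z)) \<and>
     (\<forall>x y :: int^'n. \<forall>\<tau>\<in>upper_half_plane. \<forall>z.
        \<phi> \<tau> (\<chi> i. z$i + \<tau> * of_int (x$i) + of_int (y$i)) =
        (-1) ^ nat (bf G (ivec x) (ivec x) + bf G (ivec y) (ivec y)) *
        exp (- pi * \<i> * (bf G (ivec x) (ivec x) * \<tau> + 2 * bf G (ivec x) z)) * \<phi> \<tau> z) \<and>
     (\<exists>f :: real \<Rightarrow> real^'n \<Rightarrow> complex. \<forall>\<tau>\<in>upper_half_plane. \<forall>z.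
        ((\<lambda>(m, l). f m l * exp (2 * pi * \<i> * of_real m * \<tau>) * exp (2 * pi * \<i> * bf G (rvec l) z))
          has_sum \<phi> \<tau> z) (fourier_index G D))"

definition divisible_by_hyperplane :: "int^'n^'n \<Rightarrow> real^'n \<Rightarrow> nat \<Rightarrow> (complex \<Rightarrow> complex^'n \<Rightarrow> complex) \<Rightarrow> bool" where
  "divisible_by_hyperplane G v m \<phi> \<longleftrightarrow> (\<exists>g. holo_HC g \<and>
     (\<forall>\<tau>\<in>upper_half_plane. \<forall>z. \<phi> \<tau> z = bf G (rvec v) z ^ m * g \<tau> z))"

definition hyperplane_multiplicity :: "int^'n^'n \<Rightarrow> real^'n \<Rightarrow> (complex \<Rightarrow> complex^'n \<Rightarrow> complex) \<Rightarrow> nat" where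
  "hyperplane_multiplicity G v \<phi> = (GREATEST m. divisible_by_hyperplane G v m \<phi>)"

definition reflection :: "int^'n^'n \<Rightarrow> real^'n \<Rightarrow> complex^'n \<Rightarrow> complex^'n" where
  "reflection G v z = (\<chi> i. z$i - (2 * bf G (rvec v) z / bf G (rvec v) (rvec v)) * rvec v $ i)"

end

theory Submission
  imports Defs
begin

unbundle no fps_syntax

text \<open>
  In singular weight the coefficients \<open>h\<^sub>\<mu>(\<tau>)\<close> of the theta decomposition
  \<open>\<phi>(\<tau>, z) = \<Sum>\<^sub>l h\<^sub>l(\<tau>) e(\<tau>(l,l)/2 + (l,z))\<close> have weight 0. The sum
  \<open>\<Sum>|h\<^sub>\<mu>|\<^sup>2\<close> over the finitely many classes of the shadow modulo the lattice is invariant under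
  \<open>\<tau> \<mapsto> -1/\<tau>\<close>: up to a Gaussian integral it is the squared norm of
  \<open>(x, y) \<mapsto> e(\<tau>(x,x)/2) \<phi>(\<tau>, x\<tau> + y)\<close> on the torus. It is bounded at the cusp, hence attains its maximum, and
  the maximum principle makes every \<open>h\<^sub>\<mu>\<close> constant; this is the heat equation for \<open>\<phi>\<close>.
  Restricting \<open>\<phi> = \<Sum>\<^sub>l c\<^sub>l e(\<tau>(l,l)/2 + (l,z))\<close> to the hyperplane orthogonal to \<open>v\<close>, the terms of
  \<open>l\<close> and \<open>\<sigma>\<^sub>v(l)\<close> are the only ones sharing a frequency in \<open>\<tau>\<close> and \<open>z\<close>. So vanishing there means
  \<open>c(\<sigma>\<^sub>v l) = - c(l)\<close>, which is the antisymmetry, and vanishing of the quotient \<open>\<phi> / (v,z)\<close> there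
  forces \<open>c = 0\<close>.
\<close>

section \<open>Exponential sums and the unit cube\<close>

text \<open>The singular weight enters through one cancellation: the inversion multiplies the torus
  norm by |\<tau>|^rk, and the Gaussian integral at Im(-1/\<tau>) = Im \<tau>/|\<tau>|^2 is
  |\<tau>|^rk times the one at Im \<tau>. In another weight a power of |\<tau>| would survive and
  the sum of squares would not be invariant. The inversion mixes the components h_\<mu>, but the
  torus integral records only their sum of squares, so the mixing matrix never has to be computed.
  On the hyperplane, the coefficients of the quotient are, up to a constant, c(l) times the
  v-component of l. Both factors change sign under \<sigma>_v, so these coefficients are symmetric,
  while vanishing would make them antisymmetric; this excludes a second zero.\<close>

lemma half_one_plus_exp_norm_le: "norm ((1 + exp (\<i> * complex_of_real x)) / 2) \<le> 1"
proof -
  have "norm (1 + exp (\<i> * complex_of_real x)) \<le> 1 + 1"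
    by (rule order_trans[OF norm_triangle_ineq]) simp
  then show ?thesis by (simp add: norm_divide)
qed

text \<open>The operator \<open>f \<mapsto> (f(s) + f(s + t)) / 2\<close> with \<open>t = \<pi> \<omega>\<^sub>j / |\<omega>\<^sub>j|\<^sup>2\<close> annihilates the
  frequency \<open>\<omega>\<^sub>j\<close>, fixes the frequency 0 and does not increase any coefficient; finitely many of
  these operators leave only the frequency 0 and an arbitrarily small tail.\<close>

lemma has_sum_exponentials_zero_frequency:
  fixes a :: "'k \<Rightarrow> complex" and \<omega> :: "'k \<Rightarrow> 'e::real_inner"
  assumes summ: "a summable_on K"
    and zero: "\<And>s. ((\<lambda>k. a k * exp (\<i> * complex_of_real (\<omega> k \<bullet> s))) has_sum 0) K"
  shows "(a has_sum 0) {k\<in>K. \<omega> k = 0}"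
proof -
  define m where "m = (\<lambda>F k. \<Prod>j\<in>F. (1 + exp (\<i> * complex_of_real (\<omega> k \<bullet> ((pi / (\<omega> j \<bullet> \<omega> j)) *\<^sub>R \<omega> j)))) / 2)"
  have m_sum: "((\<lambda>k. a k * m F k * exp (\<i> * complex_of_real (\<omega> k \<bullet> s))) has_sum 0) K" if "finite F" for F s
    using that
  proof (induction F arbitrary: s rule: finite_induct)
    case empty
    then show ?case using zero[of s] by (simp add: m_def)
  next
    case (insert j F)
    define t where "t = (pi / (\<omega> j \<bullet> \<omega> j)) *\<^sub>R \<omega> j"
    have "((\<lambda>k. (1/2) * (a k * m F k * exp (\<i> * complex_of_real (\<omega> k \<bullet> s)) +
        a k * m F k * exp (\<i> * complex_of_real (\<omega> k \<bullet> (s + t))))) has_sum ((1/2) * (0 + 0))) K"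
      by (intro has_sum_cmult_right has_sum_add insert.IH)
    moreover have "(1/2) * (a k * m F k * exp (\<i> * complex_of_real (\<omega> k \<bullet> s)) +
        a k * m F k * exp (\<i> * complex_of_real (\<omega> k \<bullet> (s + t)))) =
        a k * m (insert j F) k * exp (\<i> * complex_of_real (\<omega> k \<bullet> s))" for k
    proof -
      have "m (insert j F) k = (1 + exp (\<i> * complex_of_real (\<omega> k \<bullet> t))) / 2 * m F k"
        using insert.hyps by (simp add: m_def t_def)
      then show ?thesis
        by (simp only: inner_add_right of_real_add distrib_left exp_add) (simp add: algebra_simps)
    qed
    ultimately show ?case by simp
  qed
  have m_norm: "norm (m F k) \<le> 1" for F k
    unfolding m_def prod_norm[symmetric]
    by (intro prod_le_1 conjI norm_ge_zero half_one_plus_exp_norm_le)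
  have m_zero: "m F k = 0" if "finite F" "k \<in> F" "\<omega> k \<noteq> 0" for F k
  proof -
    have "\<omega> k \<bullet> ((pi / (\<omega> k \<bullet> \<omega> k)) *\<^sub>R \<omega> k) = pi"
      using that(3) by simp
    then have "exp (\<i> * complex_of_real (\<omega> k \<bullet> ((pi / (\<omega> k \<bullet> \<omega> k)) *\<^sub>R \<omega> k))) = - 1"
      by (simp only: mult.commute[of \<i>] exp_pi_i)
    then have "(1 + exp (\<i> * complex_of_real (\<omega> k \<bullet> ((pi / (\<omega> k \<bullet> \<omega> k)) *\<^sub>R \<omega> k)))) / 2 = 0"
      by simp
    with that(1,2) show ?thesis unfolding m_def by (intro prod_zero bexI)
  qed
  have m_one: "m F k = 1" if "\<omega> k = 0" for F k
    using that by (simp add: m_def)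
  define B where "B = {k\<in>K. \<omega> k = 0}"
  have summB: "a summable_on B"
    using summ by (rule summable_on_subset_banach) (auto simp: B_def)
  have nsum: "(\<lambda>k. norm (a k)) summable_on K"
    using summ summable_on_iff_abs_summable_on_complex by blast
  have "norm (infsum a B) \<le> \<epsilon>" if "\<epsilon> > 0" for \<epsilon>
  proof -
    obtain F where F: "finite F" "F \<subseteq> K" "dist (sum (\<lambda>k. norm (a k)) F) (infsum (\<lambda>k. norm (a k)) K) \<le> \<epsilon>"
      using infsum_finite_approximation[OF nsum \<open>\<epsilon> > 0\<close>] by blast
    \<comment> \<open>The damped series still has sum 0. Its difference \<open>d\<close> from the
      frequency 0 part vanishes on \<open>F\<close> and is bounded by \<open>norm (a k)\<close>
      elsewhere, so the tail of \<open>a\<close> controls that part.\<close>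
    define d where "d = (\<lambda>k. a k * m F k - (if k \<in> B then a k else 0))"
    have "((\<lambda>k. if k \<in> B then a k else 0) has_sum infsum a B) K"
      using has_sum_infsum[OF summB]
      by (rule has_sum_cong_neutral[THEN iffD1, rotated -1]) (auto simp: B_def)
    then have d_sum: "(d has_sum (0 - infsum a B)) K"
      unfolding d_def diff_conv_add_uminus
      by (intro has_sum_add has_sum_uminusI) (use m_sum[OF F(1), of 0] in auto)
    have dn: "((\<lambda>k. norm (d k)) has_sum (\<Sum>\<^sub>\<infinity>k\<in>K. norm (d k))) K"
      using has_sum_imp_summable[OF d_sum] unfolding summable_on_iff_abs_summable_on_complex[of d]
      by (rule has_sum_infsum)
    have tail: "((\<lambda>k. norm (a k)) has_sum (infsum (\<lambda>k. norm (a k)) K - sum (\<lambda>k. norm (a k)) F)) (K - F)"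
      by (rule has_sum_Diff) (use F nsum in auto)
    then have tail2: "((\<lambda>k. if k \<in> F then 0 else norm (a k)) has_sum (infsum (\<lambda>k. norm (a k)) K - sum (\<lambda>k. norm (a k)) F)) K"
      by (rule has_sum_cong_neutral[THEN iffD1, rotated -1]) auto
    have d_le: "norm (d k) \<le> (if k \<in> F then 0 else norm (a k))" if "k \<in> K" for k
    proof (cases "\<omega> k = 0")
      case True
      then show ?thesis using that by (simp add: d_def B_def m_one)
    next
      case False
      then have "norm (d k) = norm (a k) * norm (m F k)"
        by (simp add: d_def B_def norm_mult)
      then show ?thesis using m_norm[of F k] m_zero[OF F(1), of k] False
        by (auto intro: mult_left_le)
    qed
    have "norm (0 - infsum a B) \<le> infsum (\<lambda>k. norm (a k)) K - sum (\<lambda>k. norm (a k)) F"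
      by (rule order_trans[OF norm_has_sum_bound[OF dn d_sum] has_sum_mono[OF dn tail2 d_le]])
    then show ?thesis using F(3) by (simp add: dist_real_def)
  qed
  from this[of "norm (infsum a B) / 2"] have "infsum a B = 0"
    by (cases "infsum a B = 0") auto
  then show ?thesis using has_sum_infsum[OF summB] by (simp add: B_def)
qed

text \<open>Multiplication by exp(-i (c, s)) moves the frequency c to 0. Different indices may share
  a frequency, so the conclusion concerns a fibre of \<open>\<omega>\<close>: a single index in
  \<open>theta_coeff_shift\<close>, a pair l, \<sigma>_v(l) in
  \<open>coefficient_pairing\<close>.\<close>

corollary has_sum_exponentials_frequency:
  fixes a :: "'k \<Rightarrow> complex" and \<omega> :: "'k \<Rightarrow> 'e::real_inner"
  assumes summ: "a summable_on K"
    and zero: "\<And>s. ((\<lambda>k. a k * exp (\<i> * complex_of_real (\<omega> k \<bullet> s))) has_sum 0) K"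
  shows "(a has_sum 0) {k\<in>K. \<omega> k = c}"
proof -
  have "((\<lambda>k. a k * exp (\<i> * complex_of_real ((\<omega> k - c) \<bullet> s))) has_sum 0) K" for s
  proof -
    have "((\<lambda>k. exp (- \<i> * complex_of_real (c \<bullet> s)) * (a k * exp (\<i> * complex_of_real (\<omega> k \<bullet> s)))) has_sum
       (exp (- \<i> * complex_of_real (c \<bullet> s)) * 0)) K"
      by (intro has_sum_cmult_right zero)
    then show ?thesis
      by (simp add: inner_diff_left ring_distribs exp_diff exp_minus field_simps)
  qed
  from has_sum_exponentials_zero_frequency[OF summ this] show ?thesis by simp
qed

text \<open>Half-open, so that its integer translates tile space exactly. It plays two roles:
  fundamental domain for the torus integrals and, intersected with the shadow, a set of
  representatives modulo the lattice.\<close>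

definition unit_cube :: "(real^'n) set" where
  "unit_cube = {x. \<forall>i. 0 \<le> x$i \<and> x$i < 1}"

lemma indicator_unit_cube:
  "indicator unit_cube (x::real^'n) = (\<Prod>b\<in>Basis. indicator {0..<1} (x \<bullet> b) :: 'a::{comm_semiring_1,semidom})"
proof (cases "x \<in> unit_cube")
  case True
  then show ?thesis
    by (intro trans[OF indicator_simps(1) prod.neutral[symmetric]])
       (auto simp: unit_cube_def Basis_vec_def inner_axis)
next
  case False
  then obtain i where "\<not> (0 \<le> x$i \<and> x$i < 1)" by (auto simp: unit_cube_def)
  then have "(\<Prod>b\<in>Basis. indicator {0..<1} (x \<bullet> b) :: 'a) = 0"
    by (intro prod_zero bexI[of _ "axis i 1"]) (auto simp: inner_axis axis_in_Basis_iff)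
  then show ?thesis using False by simp
qed

lemma unit_cube_measurable [measurable]: "unit_cube \<in> sets borel"
proof -
  have "unit_cube = (\<Inter>i. {x::real^'n. 0 \<le> x$i} \<inter> {x. x$i < 1})"
    by (auto simp: unit_cube_def)
  also have "\<dots> \<in> sets borel"
    by (intro sets.countable_INT' sets.Int borel_closed borel_open closed_Collect_le open_Collect_less continuous_intros)
       (auto simp: countable_finite)
  finally show ?thesis .
qed

lemma emeasure_unit_cube [simp]: "emeasure lborel (unit_cube :: (real^'n) set) = 1"
proof -
  have [simp]: "ennreal (indicator A (x::'b)) = indicator A x" for A x
    by (simp add: indicator_def)
  have "emeasure lborel (unit_cube :: (real^'n) set) = (\<integral>\<^sup>+x. ennreal (\<Prod>b\<in>Basis. indicator {0..<1} ((x::real^'n) \<bullet> b)) \<partial>lborel)"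
    by (simp add: indicator_unit_cube[symmetric] ennreal_indicator)
  also have "\<dots> = (\<integral>\<^sup>+x. (\<Prod>b\<in>Basis. ennreal (indicator {0..<1} ((x::real^'n) \<bullet> b))) \<partial>lborel)"
    by (subst prod_ennreal) auto
  also have "\<dots> = (\<Prod>b\<in>(Basis::(real^'n) set). (\<integral>\<^sup>+x. ennreal (indicator {0..<1} (x::real)) \<partial>lborel))"
    using nn_integral_lborel_prod[where f="\<lambda>b::real^'n. \<lambda>x::real. indicator {0..<1} x"] by simp
  also have "\<dots> = 1" by (simp add: ennreal_indicator)
  finally show ?thesis .
qed

section \<open>Orthogonality of characters and Parseval's identity on the torus\<close>

lemma integral_exp_2pi_int:
  fixes k :: int
  shows "(LINT x|lborel. indicator {0..<1} x *\<^sub>R exp (2 * pi * \<i> * of_int k * complex_of_real x)) = (if k = 0 then 1 else 0)"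
    and "integrable lborel (\<lambda>x::real. indicator {0..<1} x *\<^sub>R exp (2 * pi * \<i> * of_int k * complex_of_real x))"
proof -
  let ?f = "\<lambda>x::real. exp (2 * pi * \<i> * of_int k * complex_of_real x)"
  have ae: "AE x in lborel. indicator {0..<1} x *\<^sub>R ?f x = indicator {0..1} x *\<^sub>R ?f x"
    using AE_lborel_singleton[of "1::real"] by eventually_elim (auto simp: indicator_def)
  have i1: "integrable lborel (\<lambda>x. indicator {0..1} x *\<^sub>R ?f x)"
    by (intro borel_integrable_compact continuous_intros) auto
  show i2: "integrable lborel (\<lambda>x::real. indicator {0..<1} x *\<^sub>R ?f x)"
    by (subst integrable_cong_AE[OF _ _ ae]) (use i1 in auto)
  have "(LINT x|lborel. indicator {0..<1} x *\<^sub>R ?f x) = (LINT x|lborel. indicator {0..1} x *\<^sub>R ?f x)"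
    by (rule integral_cong_AE) (use ae in auto)
  also have "\<dots> = (if k = 0 then 1 else 0)"
  proof (cases "k = 0")
    case True
    then show ?thesis by (simp add: scaleR_conv_of_real)
  next
    case False
    let ?c = "2 * pi * \<i> * of_int k :: complex"
    have c: "?c \<noteq> 0" using False by simp
    have "(LINT x|lborel. indicator {0..1} x *\<^sub>R ?f x) = exp (?c * complex_of_real 1) / ?c - exp (?c * complex_of_real 0) / ?c"
    proof (rule integral_FTC_Icc[where F="\<lambda>x. exp (?c * complex_of_real x) / ?c"])
      fix x :: real
      have "((\<lambda>z. exp (?c * z) / ?c) has_field_derivative exp (?c * complex_of_real x)) (at (complex_of_real x))"
        using c by (auto intro!: derivative_eq_intros)
      from has_vector_derivative_real_field[OF this]
      show "((\<lambda>x. exp (?c * complex_of_real x) / ?c) has_vector_derivative ?f x) (at x within {0..1})"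
        by simp
    qed (auto intro!: continuous_intros)
    also have "exp (?c * complex_of_real 1) = 1"
      using exp_integer_2pi[of "of_int k"] by (simp add: mult_ac)
    finally show ?thesis using False by simp
  qed
  finally show "(LINT x|lborel. indicator {0..<1} x *\<^sub>R ?f x) = (if k = 0 then 1 else 0)" .
qed

lemma integral_unit_cube_character:
  fixes k :: "int^'n"
  shows "(LINT y::real^'n|lborel. indicator unit_cube y *\<^sub>R exp (2 * pi * \<i> * complex_of_real (\<Sum>i\<in>UNIV. of_int (k$i) * y$i))) = (if k = 0 then 1 else 0)"
proof -
  interpret product_sigma_finite "\<lambda>_::real^'n. lborel :: real measure"
    by standard
  \<comment> \<open>The product measure is indexed by basis vectors b = \<open>axis i 1\<close>, so
    a coordinate of \<open>k\<close> is read off as an inner product with b; the floor returns it to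
    type int without loss.\<close>
  define g where "g = (\<lambda>b::real^'n. \<lambda>x::real. indicator {0..<1} x *\<^sub>R exp (2 * pi * \<i> * of_int \<lfloor>(\<chi> i. real_of_int (k$i)) \<bullet> b\<rfloor> * complex_of_real x))"
  let ?f = "\<lambda>y::real^'n. indicator unit_cube y *\<^sub>R exp (2 * pi * \<i> * complex_of_real (\<Sum>i\<in>UNIV. of_int (k$i) * y$i))"
  have B: "(Basis :: (real^'n) set) = (\<lambda>i. axis i 1) ` UNIV" by (auto simp: Basis_vec_def)
  have inj: "inj (\<lambda>i. axis i 1 :: real^'n)" by (auto simp: inj_def axis_eq_axis)
  have f_eq: "?f y = (\<Prod>b\<in>Basis. g b (y \<bullet> b))" for y
  proof -
    have "(\<Prod>b\<in>Basis. g b (y \<bullet> b)) = (\<Prod>b\<in>Basis. complex_of_real (indicator {0..<1} (y \<bullet> b))) * 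
       (\<Prod>b\<in>Basis. exp (2 * pi * \<i> * of_int \<lfloor>(\<chi> i. real_of_int (k$i)) \<bullet> b\<rfloor> * complex_of_real (y \<bullet> b)))"
      by (simp only: g_def scaleR_conv_of_real prod.distrib)
    also have "(\<Prod>b\<in>Basis. complex_of_real (indicator {0..<1} (y \<bullet> b))) = complex_of_real (indicator unit_cube y)"
      unfolding indicator_unit_cube[where 'a=real] of_real_prod ..
    also have "(\<Prod>b\<in>Basis. exp (2 * pi * \<i> * of_int \<lfloor>(\<chi> i. real_of_int (k$i)) \<bullet> b\<rfloor> * complex_of_real (y \<bullet> b)))
       = (\<Prod>i\<in>UNIV. exp (2 * pi * \<i> * of_int (k$i) * complex_of_real (y$i)))"
      unfolding B by (subst prod.reindex[OF inj]) (simp add: inner_axis)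
    also have "\<dots> = exp (2 * pi * \<i> * complex_of_real (\<Sum>i\<in>UNIV. of_int (k$i) * y$i))"
      by (simp add: exp_sum[symmetric] sum_distrib_left mult_ac)
    finally show ?thesis by (simp add: scaleR_conv_of_real)
  qed
  have "?f \<in> borel_measurable borel"
    by (intro borel_measurable_scaleR borel_measurable_indicator unit_cube_measurable borel_measurable_continuous_onI continuous_intros)
  then have "(LINT y|lborel. ?f y) = (LINT y|(\<Pi>\<^sub>M b\<in>Basis. lborel). ?f (\<Sum>b\<in>Basis. y b *\<^sub>R b))"
    by (subst lborel_eq, subst integral_distr) simp_all
  also have "\<dots> = (LINT y|(\<Pi>\<^sub>M b\<in>Basis. lborel). (\<Prod>b\<in>Basis. g b (y b)))"
    unfolding f_eq by (intro Bochner_Integration.integral_cong refl prod.cong) simp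
  also have "\<dots> = (\<Prod>b\<in>Basis. LINT x|lborel. g b x)"
    unfolding g_def by (rule product_integral_prod[OF _ integral_exp_2pi_int(2)]) simp
  also have "\<dots> = (\<Prod>b\<in>Basis. if \<lfloor>(\<chi> i. real_of_int (k$i)) \<bullet> b\<rfloor> = 0 then 1 else 0)"
    by (simp only: g_def integral_exp_2pi_int(1))
  also have "\<dots> = (\<Prod>i\<in>UNIV. if k$i = 0 then 1 else 0)"
    unfolding B by (subst prod.reindex[OF inj]) (simp add: inner_axis)
  also have "\<dots> = (if k = 0 then 1 else 0)"
    by (auto simp: vec_eq_iff)
  finally show ?thesis .
qed

lemma nn_integral_count_space_has_sum:
  fixes f :: "'k \<Rightarrow> real"
  assumes "(f has_sum s) K" and nonneg: "\<And>k. k \<in> K \<Longrightarrow> 0 \<le> f k"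
  shows "(\<integral>\<^sup>+k. ennreal (f k) \<partial>count_space K) = ennreal s"
proof -
  have "f summable_on K" using assms(1) by (rule has_sum_imp_summable)
  then have abs: "Infinite_Set_Sum.abs_summable_on f K"
    using abs_summable_equivalent summable_on_iff_abs_summable_on_real by blast
  then have "(\<integral>\<^sup>+k. ennreal (f k) \<partial>count_space K) = ennreal (infsetsum f K)"
    by (intro nn_integral_conv_infsetsum) (use nonneg in auto)
  also have "infsetsum f K = s"
    using abs assms(1) by (simp add: infsetsum_infsum infsumI)
  finally show ?thesis .
qed

lemma has_sum_norm_tail_bound:
  fixes b :: "'k \<Rightarrow> complex"
  assumes b: "(b has_sum B) K" and le: "\<And>k. k \<in> K \<Longrightarrow> norm (b k) \<le> a k"
    and a: "(a has_sum A) K" and F: "finite F" "F \<subseteq> K"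
  shows "norm (B - sum b F) \<le> A - sum a F"
proof -
  have bF: "(b has_sum (B - sum b F)) (K - F)"
    by (rule has_sum_Diff) (use b F in auto)
  have aF: "(a has_sum (A - sum a F)) (K - F)"
    by (rule has_sum_Diff) (use a F in auto)
  have nb: "((\<lambda>k. norm (b k)) has_sum (\<Sum>\<^sub>\<infinity>k\<in>K-F. norm (b k))) (K - F)"
    using has_sum_imp_summable[OF bF] unfolding summable_on_iff_abs_summable_on_complex[of b]
    by (rule has_sum_infsum)
  show ?thesis
    by (rule order_trans[OF norm_has_sum_bound[OF nb bF] has_sum_mono[OF nb aF]]) (use le in auto)
qed

lemma norm_exp_2pi_real [simp]: "norm (exp (2 * complex_of_real pi * \<i> * complex_of_real x)) = 1"
  by (simp add: norm_exp_eq_Re)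

text \<open>Absolute summability makes the finite partial sums converge uniformly, and for these the
  identity is orthogonality of characters. Only differences of frequencies enter |\<Phi>|^2, so a
  coset of the integer vectors is admissible, as it arises from the shadow. Both sides are
  nonnegative extended integrals, ready for Tonelli.\<close>

lemma parseval_unit_cube:
  fixes a :: "'k \<Rightarrow> complex" and \<omega> :: "'k \<Rightarrow> real^'n"
  assumes summ: "a summable_on K" and inj: "inj_on \<omega> K"
    and int_diff: "\<And>j k. j \<in> K \<Longrightarrow> k \<in> K \<Longrightarrow> \<exists>p::int^'n. \<omega> j - \<omega> k = ivec p"
    and \<Phi>: "\<And>y. ((\<lambda>k. a k * exp (2 * pi * \<i> * complex_of_real (\<omega> k \<bullet> y))) has_sum \<Phi> y) K"
  shows "(\<integral>\<^sup>+y. ennreal ((norm (\<Phi> y))\<^sup>2) * indicator unit_cube y \<partial>lborel) =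
         (\<integral>\<^sup>+k. ennreal ((norm (a k))\<^sup>2) \<partial>count_space K)"
proof -
  define S where "S = (\<lambda>F y. \<Sum>k\<in>F. a k * exp (2 * pi * \<i> * complex_of_real (\<omega> k \<bullet> y)))"
  define A where "A = (\<Sum>\<^sub>\<infinity>k\<in>K. norm (a k))"
  have nsum: "((\<lambda>k. norm (a k)) has_sum A) K"
    unfolding A_def using summ summable_on_iff_abs_summable_on_complex by (blast intro: has_sum_infsum)
  have nle: "norm (a k * exp (2 * pi * \<i> * complex_of_real (\<omega> k \<bullet> y))) \<le> norm (a k)" for k y
    by (simp add: norm_mult)
  have tail: "norm (\<Phi> y - S F y) \<le> A - (\<Sum>k\<in>F. norm (a k))" if "finite F" "F \<subseteq> K" for F y
    unfolding S_def by (rule has_sum_norm_tail_bound[OF \<Phi> nle nsum that])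
  have A0: "A \<ge> 0" using nsum by (rule has_sum_nonneg) auto
  have S_le: "norm (S F y) \<le> A" if "finite F" "F \<subseteq> K" for F y
  proof -
    have "norm (S F y) \<le> (\<Sum>k\<in>F. norm (a k))"
      unfolding S_def by (rule order_trans[OF norm_sum sum_mono[OF nle]])
    also have "\<dots> \<le> A" by (rule finite_sum_le_has_sum[OF nsum that]) auto
    finally show ?thesis .
  qed
  have \<Phi>_le: "norm (\<Phi> y) \<le> A" for y using tail[of "{}" y] by (simp add: S_def)
  have lim: "((\<lambda>F. A - (\<Sum>k\<in>F. norm (a k))) \<longlongrightarrow> 0) (finite_subsets_at_top K)"
    using tendsto_diff[OF tendsto_const[of A] nsum[unfolded has_sum_def]] by simp
  have fin: "eventually (\<lambda>F. finite F \<and> F \<subseteq> K) (finite_subsets_at_top K)"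
    by (rule eventually_finite_subsets_at_top_weakI) auto
  have "uniform_limit UNIV S \<Phi> (finite_subsets_at_top K)"
    unfolding S_def by (rule Weierstrass_m_test_general'[OF nle \<Phi> has_sum_imp_summable[OF nsum]])
  then have "continuous_on UNIV \<Phi>"
    by (rule uniform_limit_theorem[rotated])
       (auto simp: S_def intro!: always_eventually continuous_intros)
  then have [measurable]: "\<Phi> \<in> borel_measurable borel"
    by (rule borel_measurable_continuous_onI)
  have S_meas [measurable]: "S F \<in> borel_measurable borel" for F
    unfolding S_def by (intro borel_measurable_continuous_onI continuous_intros)
  have Q_int: "integrable lborel (\<lambda>y. indicator unit_cube y *\<^sub>R g y)"
    if [measurable]: "g \<in> borel_measurable borel" and g: "\<And>y::real^'n. norm (g y) \<le> B" 
    for g :: "real^'n \<Rightarrow> 'b::{second_countable_topology,banach}" and B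
  proof (rule Bochner_Integration.integrable_bound[where f="\<lambda>y. indicator unit_cube y *\<^sub>R B"])
    show "integrable lborel (\<lambda>y::real^'n. indicat_real unit_cube y *\<^sub>R B)"
      by (rule integrable_scaleR_left) (simp add: integrable_indicator_iff)
    show "AE y in lborel. norm (indicat_real unit_cube y *\<^sub>R g y) \<le> norm (indicat_real unit_cube y *\<^sub>R B)"
      using g by (intro AE_I2) (auto simp: indicator_def intro: order_trans[OF _ abs_ge_self])
  qed simp
  have finite_case: "(LINT y|lborel. indicator unit_cube y *\<^sub>R (norm (S F y))\<^sup>2) = (\<Sum>k\<in>F. (norm (a k))\<^sup>2)"
    if F: "finite F" "F \<subseteq> K" for F
  proof -
    let ?e = "\<lambda>k y. exp (2 * pi * \<i> * complex_of_real (\<omega> k \<bullet> y))"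
    let ?E = "\<lambda>j k y. indicator unit_cube y *\<^sub>R exp (2 * pi * \<i> * complex_of_real ((\<omega> j - \<omega> k) \<bullet> y))"
    have e_cnj: "?e j y * cnj (?e k y) = exp (2 * pi * \<i> * complex_of_real ((\<omega> j - \<omega> k) \<bullet> y))" for j k y
      by (simp add: exp_cnj inner_diff_left exp_add[symmetric] algebra_simps)
    have E_int: "integrable lborel (?E j k)" for j k
      by (rule Q_int[of _ 1]) (auto intro!: borel_measurable_continuous_onI continuous_intros)
    have E_val: "(LINT y|lborel. ?E j k y) = (if j = k then 1 else 0)" if jk: "j \<in> F" "k \<in> F" for j k
    proof -
      obtain p :: "int^'n" where p: "\<omega> j - \<omega> k = ivec p" using int_diff jk F by blast
      have "(LINT y|lborel. ?E j k y) = (if p = 0 then 1 else 0)"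
        using integral_unit_cube_character[of p] by (simp add: p inner_vec_def ivec_def)
      also have "p = 0 \<longleftrightarrow> j = k"
      proof
        assume "p = 0" then have "\<omega> j = \<omega> k" using p by (simp add: ivec_def vec_eq_iff)
        then show "j = k" using inj jk F by (auto dest: inj_onD)
      next
        assume "j = k" then show "p = 0" using p by (simp add: ivec_def vec_eq_iff)
      qed
      finally show ?thesis .
    qed
    have expand: "complex_of_real (indicator unit_cube y *\<^sub>R (norm (S F y))\<^sup>2) = (\<Sum>j\<in>F. \<Sum>k\<in>F. (a j * cnj (a k)) * ?E j k y)" for y
    proof -
      have "complex_of_real ((norm (S F y))\<^sup>2) = (\<Sum>j\<in>F. \<Sum>k\<in>F. (a j * ?e j y) * (cnj (a k) * cnj (?e k y)))"
        by (simp only: complex_norm_square S_def cnj_sum complex_cnj_mult sum_product)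
      also have "\<dots> = (\<Sum>j\<in>F. \<Sum>k\<in>F. (a j * cnj (a k)) * (?e j y * cnj (?e k y)))"
        by (simp only: mult_ac)
      finally have "complex_of_real ((norm (S F y))\<^sup>2) = (\<Sum>j\<in>F. \<Sum>k\<in>F. (a j * cnj (a k)) * exp (2 * pi * \<i> * complex_of_real ((\<omega> j - \<omega> k) \<bullet> y)))"
        unfolding e_cnj .
      then show ?thesis
        by (simp only: scaleR_conv_of_real of_real_mult real_scaleR_def of_real_eq_id id_apply sum_distrib_left mult_ac)
    qed
    have "complex_of_real (LINT y|lborel. indicator unit_cube y *\<^sub>R (norm (S F y))\<^sup>2) =
       (LINT y|lborel. complex_of_real (indicator unit_cube y *\<^sub>R (norm (S F y))\<^sup>2))"
      by (rule integral_complex_of_real[symmetric])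
    also have "\<dots> = (\<Sum>j\<in>F. \<Sum>k\<in>F. (a j * cnj (a k)) * (LINT y|lborel. ?E j k y))"
      unfolding expand
      by (subst Bochner_Integration.integral_sum; (intro Bochner_Integration.integrable_sum integrable_mult_right E_int)?)+
         (simp only: integral_mult_right_zero)
    also have "\<dots> = (\<Sum>j\<in>F. \<Sum>k\<in>F. (a j * cnj (a k)) * (if j = k then 1 else 0))"
      by (intro sum.cong refl arg_cong2[of _ _ _ _ "(*)"] E_val)
    also have "\<dots> = (\<Sum>j\<in>F. a j * cnj (a j))"
      using F(1) by (simp add: if_distrib[of "\<lambda>x. _ * x"] cong: if_cong)
    also have "\<dots> = complex_of_real (\<Sum>k\<in>F. (norm (a k))\<^sup>2)"
      by (simp only: of_real_sum complex_norm_square)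
    finally show ?thesis by (simp only: of_real_eq_iff)
  qed
  have \<Phi>_int: "integrable lborel (\<lambda>y. indicator unit_cube y *\<^sub>R (norm (\<Phi> y))\<^sup>2)"
    by (rule Q_int[of _ "A\<^sup>2"]) (auto intro!: power_mono \<Phi>_le)
  define I where "I = (LINT y|lborel. indicator unit_cube y *\<^sub>R (norm (\<Phi> y))\<^sup>2)"
  \<comment> \<open>The factor 2A comes from |s|^2 - |t|^2 = (|s| + |t|)(|s| - |t|): the partial sum
    and \<open>\<Phi>\<close> are both bounded by \<open>A\<close>, and their distance by the
    tail.\<close>
  have bound: "\<bar>(\<Sum>k\<in>F. (norm (a k))\<^sup>2) - I\<bar> \<le> 2 * A * (A - (\<Sum>k\<in>F. norm (a k)))"
    if F: "finite F" "F \<subseteq> K" for F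
  proof -
    define \<epsilon> where "\<epsilon> = A - (\<Sum>k\<in>F. norm (a k))"
    have S_int: "integrable lborel (\<lambda>y. indicator unit_cube y *\<^sub>R (norm (S F y))\<^sup>2)"
      by (rule Q_int[of _ "A\<^sup>2"]) (auto intro!: power_mono S_le F)
    have pw: "\<bar>(norm (S F y))\<^sup>2 - (norm (\<Phi> y))\<^sup>2\<bar> \<le> 2 * A * \<epsilon>" for y
    proof -
      have "\<bar>(norm (S F y))\<^sup>2 - (norm (\<Phi> y))\<^sup>2\<bar> = \<bar>norm (S F y) + norm (\<Phi> y)\<bar> * \<bar>norm (S F y) - norm (\<Phi> y)\<bar>"
        by (simp only: abs_mult[symmetric] power2_eq_square square_diff_square_factored)
      also have "\<dots> \<le> (2 * A) * \<epsilon>"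
      proof (rule mult_mono)
        show "\<bar>norm (S F y) + norm (\<Phi> y)\<bar> \<le> 2 * A" using S_le[OF F, of y] \<Phi>_le[of y] by simp
        show "\<bar>norm (S F y) - norm (\<Phi> y)\<bar> \<le> \<epsilon>"
          using tail[OF F, of y] norm_triangle_ineq3[of "S F y" "\<Phi> y"] by (simp add: \<epsilon>_def norm_minus_commute)
      qed (use A0 in auto)
      finally show ?thesis .
    qed
    have "(\<Sum>k\<in>F. (norm (a k))\<^sup>2) - I = (LINT y|lborel. indicator unit_cube y *\<^sub>R (norm (S F y))\<^sup>2 - indicator unit_cube y *\<^sub>R (norm (\<Phi> y))\<^sup>2)"
      unfolding finite_case[OF F, symmetric] I_def
      by (rule Bochner_Integration.integral_diff[symmetric, OF S_int \<Phi>_int])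
    also have "\<bar>\<dots>\<bar> \<le> (LINT y::real^'n|lborel. indicator unit_cube y *\<^sub>R (2 * A * \<epsilon>))"
      unfolding real_norm_def[symmetric]
    proof (rule order_trans[OF integral_norm_bound integral_mono])
      show "integrable lborel (\<lambda>y. norm (indicator unit_cube y *\<^sub>R (norm (S F y))\<^sup>2 - indicator unit_cube y *\<^sub>R (norm (\<Phi> y))\<^sup>2))"
        by (rule integrable_norm, rule Bochner_Integration.integrable_diff[OF S_int \<Phi>_int])
      show "integrable lborel (\<lambda>y::real^'n. indicat_real unit_cube y *\<^sub>R (2 * A * \<epsilon>))"
        by (rule Q_int[of _ "norm (2 * A * \<epsilon>)"]) auto
      show "norm (indicat_real unit_cube y *\<^sub>R (norm (S F y))\<^sup>2 - indicat_real unit_cube y *\<^sub>R (norm (\<Phi> y))\<^sup>2)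
          \<le> indicat_real unit_cube y *\<^sub>R (2 * A * \<epsilon>)" for y
        using pw[of y] by (cases "y \<in> unit_cube") auto
    qed
    also have "\<dots> = 2 * A * \<epsilon>" by (simp add: measure_def)
    finally show ?thesis unfolding \<epsilon>_def .
  qed
  have "((\<lambda>F. \<Sum>k\<in>F. (norm (a k))\<^sup>2) \<longlongrightarrow> I) (finite_subsets_at_top K)"
  proof (rule LIM_zero_cancel, rule Lim_null_comparison)
    show "((\<lambda>F. 2 * A * (A - (\<Sum>k\<in>F. norm (a k)))) \<longlongrightarrow> 0) (finite_subsets_at_top K)"
      using tendsto_mult_left[OF lim, of "2 * A"] by simp
    show "eventually (\<lambda>F. norm ((\<Sum>k\<in>F. (norm (a k))\<^sup>2) - I) \<le> 2 * A * (A - (\<Sum>k\<in>F. norm (a k)))) (finite_subsets_at_top K)"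
      using fin by eventually_elim (use bound in auto)
  qed
  then have "((\<lambda>k. (norm (a k))\<^sup>2) has_sum I) K" by (simp add: has_sum_def)
  then have "(\<integral>\<^sup>+k. ennreal ((norm (a k))\<^sup>2) \<partial>count_space K) = ennreal I"
    by (rule nn_integral_count_space_has_sum) simp
  also have "\<dots> = (\<integral>\<^sup>+y. ennreal (indicator unit_cube y *\<^sub>R (norm (\<Phi> y))\<^sup>2) \<partial>lborel)"
    unfolding I_def by (rule nn_integral_eq_integral[OF \<Phi>_int, symmetric]) simp
  also have "\<dots> = (\<integral>\<^sup>+y. ennreal ((norm (\<Phi> y))\<^sup>2) * indicator unit_cube y \<partial>lborel)"
    by (intro nn_integral_cong) (auto simp: indicator_def)
  finally show ?thesis by simp
qed

section \<open>The bilinear form and the shadow\<close>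

definition ee :: "complex \<Rightarrow> complex" where
  "ee x = exp (2 * pi * \<i> * x)"

lemma ee_add: "ee (x + y) = ee x * ee y"
  by (simp add: ee_def distrib_left exp_add)

lemma ee_minus: "ee (- x) = inverse (ee x)"
  by (simp add: ee_def exp_minus)

lemma ee_diff: "ee (x - y) = ee x / ee y"
  by (simp add: ee_def right_diff_distrib exp_diff)

lemma ee_0 [simp]: "ee 0 = 1" and ee_nonzero [simp]: "ee x \<noteq> 0"
  by (simp_all add: ee_def)

lemma norm_ee: "norm (ee x) = exp (- 2 * pi * Im x)"
  by (simp add: ee_def norm_exp_eq_Re)

lemma ee_int: "x \<in> \<int> \<Longrightarrow> ee (complex_of_real x) = 1"
  using exp_integer_2pi[of x] by (simp add: ee_def mult_ac)

lemma continuous_on_ee [continuous_intros]: "continuous_on S g \<Longrightarrow> continuous_on S (\<lambda>x. ee (g x))"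
  unfolding ee_def by (intro continuous_intros)

lemma holomorphic_on_ee [holomorphic_intros]: "g holomorphic_on S \<Longrightarrow> (\<lambda>x. ee (g x)) holomorphic_on S"
  unfolding ee_def by (intro holomorphic_intros)

lemma bf_add_left: "bf G (x + y) z = bf G x z + bf G y z"
  by (simp add: bf_def sum.distrib algebra_simps)

lemma bf_add_right: "bf G x (y + z) = bf G x y + bf G x z"
  by (simp add: bf_def sum.distrib algebra_simps)

lemma bf_diff_left: "bf G (x - y) z = bf G x z - bf G y z"
  by (simp add: bf_def sum_subtractf algebra_simps)

lemma bf_diff_right: "bf G x (y - z) = bf G x y - bf G x z"
  by (simp add: bf_def sum_subtractf algebra_simps)

lemma bf_minus_left: "bf G (- x) y = - bf G x y"
  by (simp add: bf_def sum_negf)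

lemma bf_minus_right: "bf G x (- y) = - bf G x y"
  by (simp add: bf_def sum_negf)

lemma bf_smult_left: "bf G (c *s x) y = c * bf G x y"
  by (simp add: bf_def sum_distrib_left algebra_simps)

lemma bf_smult_right: "bf G x (c *s y) = c * bf G x y"
  by (simp add: bf_def sum_distrib_left algebra_simps)

lemma bf_scaleR_left: "bf G (c *\<^sub>R x) y = c * bf G x (y :: real^'n)"
  by (simp add: bf_def sum_distrib_left algebra_simps)

lemma bf_scaleR_right: "bf G x (c *\<^sub>R y) = c * bf G x (y :: real^'n)"
  by (simp add: bf_def sum_distrib_left algebra_simps)

lemma bf_0_left [simp]: "bf G 0 y = 0" and bf_0_right [simp]: "bf G x 0 = 0"
  by (simp_all add: bf_def)

lemmas bf_linear = bf_add_left bf_add_right bf_diff_left bf_diff_right bf_minus_left bf_minus_right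
  bf_smult_left bf_smult_right bf_scaleR_left bf_scaleR_right

lemma rvec_add: "rvec (x + y) = rvec x + rvec y" and rvec_diff: "rvec (x - y) = rvec x - rvec y"
  and rvec_minus: "rvec (- x) = - rvec x" and rvec_scaleR: "rvec (c *\<^sub>R x) = of_real c *s rvec x"
  and rvec_0 [simp]: "rvec 0 = 0" and rvec_ivec [simp]: "rvec (ivec p) = ivec p"
  by (simp_all add: rvec_def ivec_def vec_eq_iff)

lemma bf_rvec: "bf G (rvec x) (rvec y) = of_real (bf G x y)"
  by (simp add: bf_def rvec_def)

lemma bf_ivec: "bf G (ivec x) (ivec y) = of_int (bf G x y)"
  by (simp add: bf_def ivec_def)

lemma ivec_int [simp]: "ivec (x :: int^'n) = x"
  by (simp add: ivec_def vec_eq_iff)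

lemma ivec_minus: "ivec (- x) = - ivec x"
  and ivec_0 [simp]: "ivec 0 = 0"
  by (simp_all add: ivec_def vec_eq_iff)

text \<open>The linear functional (l, -) in coordinates. It turns the form into the Euclidean inner
  product, in which torus frequencies are expressed; in these coordinates differences of shadow
  vectors are integer vectors.\<close>

definition gvec :: "int^'n^'n \<Rightarrow> real^'n \<Rightarrow> real^'n" where
  "gvec G l = (\<chi> j. \<Sum>i\<in>UNIV. l$i * of_int (G$i$j))"

lemma bf_gvec: "bf G l y = gvec G l \<bullet> y"
  unfolding bf_def gvec_def inner_vec_def
  by (subst sum.swap) (simp add: sum_distrib_right sum_distrib_left mult_ac)

lemma gvec_diff: "gvec G (x - y) = gvec G x - gvec G y"
  by (simp add: gvec_def vec_eq_iff sum_subtractf algebra_simps)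

lemma bf_rvec_complex:
  "bf G (rvec l) z = of_real (bf G l (\<chi> i. Re (z$i))) + \<i> * of_real (bf G l (\<chi> i. Im (z$i)))"
  unfolding bf_def rvec_def
  by (simp add: complex_eq_iff sum_distrib_left mult_ac)

lemma Im_bf_rvec: "Im (bf G (rvec l) z) = bf G l (\<chi> i. Im (z$i))"
  by (simp add: bf_rvec_complex)

lemma continuous_on_bf [continuous_intros]:
  fixes g h :: "'a::topological_space \<Rightarrow> 'b::{comm_ring_1,real_normed_field}^'n"
  assumes "continuous_on S g" "continuous_on S h"
  shows "continuous_on S (\<lambda>x. bf G (g x) (h x))"
  unfolding bf_def using assms by (intro continuous_intros)

lemma continuous_on_rvec [continuous_intros]:
  "continuous_on S g \<Longrightarrow> continuous_on S (\<lambda>x. rvec (g x))"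
  unfolding rvec_def by (intro continuous_intros)

lemma continuous_on_smult_vec [continuous_intros]:
  fixes g :: "'a::topological_space \<Rightarrow> complex^'n"
  shows "continuous_on S g \<Longrightarrow> continuous_on S (\<lambda>x. c *s g x)"
  unfolding vector_scalar_mult_def by (intro continuous_intros)

locale lattice_form =
  fixes G :: "int^'n^'n"
  assumes posdef: "int_pos_def_lattice G"
begin

lemma bf_sym: "bf G x y = bf G y x"
proof -
  have "\<And>i j. G$i$j = G$j$i" using posdef by (simp add: int_pos_def_lattice_def)
  then show ?thesis unfolding bf_def by (subst sum.swap) (simp add: mult_ac)
qed

lemma bf_pos: "x \<noteq> 0 \<Longrightarrow> bf G x (x::real^'n) > 0"
  using posdef by (simp add: int_pos_def_lattice_def)

lemma bf_nonneg: "bf G x (x::real^'n) \<ge> 0"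
  using bf_pos[of x] by (cases "x = 0") auto

lemma gvec_inj: "gvec G x = gvec G y \<longleftrightarrow> x = y"
proof
  assume "gvec G x = gvec G y"
  then have "bf G (x - y) (x - y) = 0"
    by (simp add: bf_gvec gvec_diff)
  then show "x = y" using bf_pos[of "x - y"] by force
qed simp

text \<open>The constant is the minimum of the form on the Euclidean unit sphere; homogeneity does
  the rest.\<close>

lemma bf_coercive: obtains \<epsilon> where "\<epsilon> > 0" "\<And>x::real^'n. bf G x x \<ge> \<epsilon> * (x \<bullet> x)"
proof -
  have "sphere (0::real^'n) 1 \<noteq> {}" by simp
  moreover have "compact (sphere (0::real^'n) 1)" by simp
  moreover have "continuous_on (sphere (0::real^'n) 1) (\<lambda>x. bf G x x)" by (intro continuous_intros)
  ultimately obtain x0 :: "real^'n" where x0: "x0 \<in> sphere 0 1" "\<And>x. x \<in> sphere 0 1 \<Longrightarrow> bf G x0 x0 \<le> bf G x x"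
    using continuous_attains_inf[of "sphere (0::real^'n) 1" "\<lambda>x. bf G x x"] by blast
  have "bf G x0 x0 > 0" using x0(1) by (intro bf_pos) auto
  moreover have "bf G x x \<ge> bf G x0 x0 * (x \<bullet> x)" for x :: "real^'n"
  proof (cases "x = 0")
    case False
    have "bf G x0 x0 \<le> bf G ((1 / norm x) *\<^sub>R x) ((1 / norm x) *\<^sub>R x)"
      using False by (intro x0(2)) simp
    then show ?thesis using False
      by (simp add: bf_linear divide_simps dot_square_norm power2_eq_square mult_ac)
  qed simp
  ultimately show ?thesis using that by blast
qed

lemma shadow_add_ivec: "l \<in> shadow G \<Longrightarrow> l + ivec p \<in> shadow G"
proof -
  assume "l \<in> shadow G"
  then have "of_int (bf G p y) + (bf G l (ivec y) - bf G (ivec y) (ivec y) / 2) \<in> (\<int> :: real set)" for y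
    by (intro Ints_add) (auto simp: shadow_def)
  then show ?thesis by (simp add: shadow_def bf_linear bf_ivec algebra_simps)
qed

text \<open>The quadratic corrections (y,y)/2 cancel in a difference, which therefore lies in the
  dual lattice; pairing it with the standard basis gives its coordinates under
  \<open>gvec\<close>.\<close>

lemma shadow_diff_int: "j \<in> shadow G \<Longrightarrow> k \<in> shadow G \<Longrightarrow> \<exists>p::int^'n. gvec G j - gvec G k = ivec p"
proof -
  assume jk: "j \<in> shadow G" "k \<in> shadow G"
  have "gvec G (j - k) $ i \<in> \<int>" for i
  proof -
    have "(bf G j (ivec (axis i 1)) - bf G (ivec (axis i 1)) (ivec (axis i 1)) / 2) -
      (bf G k (ivec (axis i 1)) - bf G (ivec (axis i 1)) (ivec (axis i 1)) / 2) \<in> \<int>"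
      using jk Ints_diff unfolding shadow_def by blast
    moreover have "ivec (axis i 1) = (axis i 1 :: real^'n)" by (auto simp: ivec_def axis_def vec_eq_iff)
    ultimately have "bf G (j - k) (axis i 1) \<in> \<int>" by (simp add: bf_linear)
    then show ?thesis by (simp add: bf_gvec inner_axis)
  qed
  then have "gvec G j - gvec G k = ivec (\<chi> i. \<lfloor>gvec G (j - k) $ i\<rfloor>)"
    by (simp add: ivec_def vec_eq_iff gvec_diff)
  then show ?thesis by blast
qed

text \<open>Relative to a fixed shadow vector \<open>k\<close>, every shadow vector has an integer
  coordinate vector \<open>q l\<close>, which determines it since \<open>gvec\<close> is injective.
  Over the cube these are bounded: the first summand of \<open>B\<close> bounds the entries of
  \<open>gvec G l\<close>, the second those of \<open>gvec G k\<close>.\<close>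

lemma finite_shadow_cube: "finite (shadow G \<inter> unit_cube)"
proof (cases "shadow G = {}")
  case False
  then obtain k where k: "k \<in> shadow G" by blast
  define B where "B = (\<Sum>i\<in>UNIV. \<Sum>j\<in>UNIV. \<bar>real_of_int (G$i$j)\<bar>) + (\<Sum>j\<in>UNIV. \<bar>gvec G k $ j\<bar>)"
  define q where "q = (\<lambda>l. SOME p::int^'n. gvec G l - gvec G k = ivec p)"
  have q: "gvec G l - gvec G k = ivec (q l)" if "l \<in> shadow G" for l
    unfolding q_def by (rule someI_ex) (rule shadow_diff_int[OF that k])
  have "inj_on q (shadow G \<inter> unit_cube)"
  proof (rule inj_onI)
    fix x y assume "x \<in> shadow G \<inter> unit_cube" "y \<in> shadow G \<inter> unit_cube" "q x = q y"
    then have "gvec G x = gvec G y" using q[of x] q[of y] by (auto simp: algebra_simps)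
    then show "x = y" by (simp add: gvec_inj)
  qed
  moreover have "finite (q ` (shadow G \<inter> unit_cube))"
  proof (rule finite_subset)
    show "q ` (shadow G \<inter> unit_cube) \<subseteq> vec_lambda ` (PiE UNIV (\<lambda>_. {-\<lceil>B\<rceil>..\<lceil>B\<rceil>}))"
    proof (rule image_subsetI)
      fix l assume l: "l \<in> shadow G \<inter> unit_cube"
      have "\<bar>q l $ j\<bar> \<le> \<lceil>B\<rceil>" for j
      proof -
        have "real_of_int (q l $ j) = gvec G l $ j - gvec G k $ j"
          using arg_cong[OF q[of l], of "\<lambda>v. v $ j"] l by (simp add: ivec_def)
        then have "\<bar>real_of_int (q l $ j)\<bar> \<le> \<bar>gvec G l $ j\<bar> + \<bar>gvec G k $ j\<bar>" by linarith
        also have "\<bar>gvec G l $ j\<bar> \<le> (\<Sum>i\<in>UNIV. \<bar>l$i * real_of_int (G$i$j)\<bar>)"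
          by (simp add: gvec_def)
        also have "\<dots> \<le> (\<Sum>i\<in>UNIV. \<Sum>j\<in>UNIV. \<bar>real_of_int (G$i$j)\<bar>)"
        proof (rule sum_mono)
          fix i
          have "\<bar>l$i * real_of_int (G$i$j)\<bar> \<le> 1 * \<bar>real_of_int (G$i$j)\<bar>"
            unfolding abs_mult using l by (intro mult_right_mono) (auto simp: unit_cube_def abs_le_iff less_imp_le intro: order_trans[of _ 0])
          also have "\<dots> \<le> (\<Sum>j\<in>UNIV. \<bar>real_of_int (G$i$j)\<bar>)"
            using member_le_sum[of j UNIV "\<lambda>j. \<bar>real_of_int (G$i$j)\<bar>"] by simp
          finally show "\<bar>l$i * real_of_int (G$i$j)\<bar> \<le> (\<Sum>j\<in>UNIV. \<bar>real_of_int (G$i$j)\<bar>)" .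
        qed
        also have "\<bar>gvec G k $ j\<bar> \<le> (\<Sum>j\<in>UNIV. \<bar>gvec G k $ j\<bar>)"
          by (rule member_le_sum) auto
        finally have "\<bar>real_of_int (q l $ j)\<bar> \<le> B" by (simp add: B_def)
        then show ?thesis by linarith
      qed
      then have "vec_nth (q l) \<in> PiE UNIV (\<lambda>_. {-\<lceil>B\<rceil>..\<lceil>B\<rceil>})"
        by (auto simp: PiE_iff abs_le_iff minus_le_iff)
      then show "q l \<in> vec_lambda ` (PiE UNIV (\<lambda>_. {-\<lceil>B\<rceil>..\<lceil>B\<rceil>}))"
        by (intro image_eqI[of _ _ "vec_nth (q l)"]) (auto simp: vec_lambda_eta)
    qed
    show "finite (vec_lambda ` (PiE (UNIV::'n set) (\<lambda>_. {-\<lceil>B\<rceil>..\<lceil>B\<rceil>})))"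
      by (intro finite_imageI finite_PiE) auto
  qed
  ultimately show ?thesis by (rule finite_imageD[rotated])
qed simp

lemma shadow_bij:
  "bij_betw (\<lambda>(\<mu>, p). \<mu> + ivec p) ((shadow G \<inter> unit_cube) \<times> (UNIV :: (int^'n) set)) (shadow G)"
proof (rule bij_betw_byWitness[where f'="\<lambda>l. (l - ivec (\<chi> i. \<lfloor>l$i\<rfloor>), \<chi> i. \<lfloor>l$i\<rfloor>)"])
  have "(\<chi> i. \<lfloor>(\<mu> + ivec p) $ i\<rfloor>) = p" if "\<mu> \<in> unit_cube" for \<mu> and p :: "int^'n"
  proof -
    have "\<lfloor>\<mu> $ i\<rfloor> = 0" for i using that by (auto simp: unit_cube_def floor_eq_iff)
    then show ?thesis by (simp add: vec_eq_iff ivec_def)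
  qed
  then show "\<forall>a\<in>(shadow G \<inter> unit_cube) \<times> UNIV. (\<lambda>l. (l - ivec (\<chi> i. \<lfloor>l$i\<rfloor>), \<chi> i. \<lfloor>l$i\<rfloor>)) ((\<lambda>(\<mu>, p). \<mu> + ivec p) a) = a"
    by auto
  show "(\<lambda>l. (l - ivec (\<chi> i. \<lfloor>l$i\<rfloor>), \<chi> i. \<lfloor>l$i\<rfloor>)) ` shadow G \<subseteq> (shadow G \<inter> unit_cube) \<times> UNIV"
  proof safe
    fix l assume l: "l \<in> shadow G"
    show "l - ivec (\<chi> i. \<lfloor>l$i\<rfloor>) \<in> shadow G"
      using shadow_add_ivec[OF l, of "- (\<chi> i. \<lfloor>l$i\<rfloor>)"] by (simp add: ivec_minus)
    show "l - ivec (\<chi> i. \<lfloor>l$i\<rfloor>) \<in> unit_cube"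
      by (auto simp: unit_cube_def ivec_def) linarith
  qed auto
qed (auto intro: shadow_add_ivec)

end

lemma countable_UNIV_int_vec: "countable (UNIV :: (int^'n) set)"
proof -
  have "countable (vec_nth ` (UNIV :: (int^'n) set))" by (rule countableI_type)
  then show ?thesis by (rule countable_image_inj_on) (auto simp: inj_def vec_nth_inject)
qed

lemma (in lattice_form) countable_shadow: "countable (shadow G)"
proof -
  have "shadow G = (\<lambda>(\<mu>, p). \<mu> + ivec p) ` ((shadow G \<inter> unit_cube) \<times> (UNIV :: (int^'n) set))"
    using shadow_bij by (simp add: bij_betw_def)
  moreover have "countable ((shadow G \<inter> unit_cube) \<times> (UNIV :: (int^'n) set))"
    by (intro countable_SIGMA countable_UNIV_int_vec countable_finite finite_shadow_cube)
  ultimately show ?thesis by (metis countable_image)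
qed

section \<open>Theta decomposition\<close>

lemma Im_minus_inverse: "Im (- 1 / \<tau>) = Im \<tau> / (norm \<tau>)\<^sup>2"
  by (simp add: Im_divide cmod_power2)

lemma Im_minus_inverse_pos: "Im \<tau> > 0 \<Longrightarrow> Im (- 1 / \<tau>) > 0"
  unfolding Im_minus_inverse by (intro divide_pos_pos zero_less_power) auto

text \<open>The Fourier indices fix the behaviour under \<tau> + 1 and under z + y for lattice
  vectors y; \<open>shift\<close> and \<open>inversion\<close> add the translation by \<tau> p and
  the map -1/\<tau>. \<open>\<epsilon>\<close> stands for the value of the multiplier at the
  inversion.\<close>

locale singular_form = lattice_form G for G :: "int^'n^'n" +
  fixes D :: int and \<phi> :: "complex \<Rightarrow> complex^'n \<Rightarrow> complex"
    and f :: "real \<Rightarrow> real^'n \<Rightarrow> complex" and \<epsilon> :: complex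
  assumes fourier: "Im \<tau> > 0 \<Longrightarrow>
      ((\<lambda>(m, l). f m l * ee (of_real m * \<tau>) * ee (bf G (rvec l) z)) has_sum \<phi> \<tau> z) (fourier_index G D)"
    and shift: "Im \<tau> > 0 \<Longrightarrow> \<phi> \<tau> (z + \<tau> *s ivec p) =
      (-1) ^ nat (bf G p p) * ee (- (of_int (bf G p p) * \<tau> / 2 + bf G (ivec p) z)) * \<phi> \<tau> z"
    and inversion: "Im \<tau> > 0 \<Longrightarrow> \<phi> (- 1 / \<tau>) ((1 / \<tau>) *s z) =
      \<epsilon> * csqrt \<tau> ^ CARD('n) * ee (bf G z z / (2 * \<tau>)) * \<phi> \<tau> z"
    and nonzero: "\<exists>\<tau> z. Im \<tau> > 0 \<and> \<phi> \<tau> z \<noteq> 0"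
begin

definition exponents :: "real^'n \<Rightarrow> real set" where
  "exponents l = {m. m - of_int D / 24 \<in> \<int> \<and> bf G l l \<le> 2 * m}"

text \<open>The h_l of the theta decomposition, indexed by vectors rather than by classes. On
  \<open>exponents l\<close> the powers m - (l,l)/2 are nonnegative: this is how holomorphy at the
  cusp enters.\<close>

definition theta_coeff :: "real^'n \<Rightarrow> complex \<Rightarrow> complex" where
  "theta_coeff l \<tau> = (\<Sum>\<^sub>\<infinity>m\<in>exponents l. f m l * ee (of_real (m - bf G l l / 2) * \<tau>))"

lemma theta_coeff_has_sum:
  assumes l: "l \<in> shadow G" and \<tau>: "Im \<tau> > 0"
  shows "((\<lambda>m. f m l * ee (of_real (m - bf G l l / 2) * \<tau>)) has_sum theta_coeff l \<tau>) (exponents l)"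
proof -
  let ?t = "\<lambda>(m, l). f m l * ee (of_real m * \<tau>) * ee (bf G (rvec l) 0)"
  have "?t summable_on ((\<lambda>m. (m, l)) ` exponents l)"
  proof (rule summable_on_subset_banach[OF has_sum_imp_summable[OF fourier[OF \<tau>]]])
    show "(\<lambda>m. (m, l)) ` exponents l \<subseteq> fourier_index G D"
      using l by (auto simp: exponents_def fourier_index_def)
  qed
  then have "(?t \<circ> (\<lambda>m. (m, l))) summable_on exponents l"
    by (subst (asm) summable_on_reindex) (auto simp: inj_on_def)
  then have "(\<lambda>m. ee (- (of_real (bf G l l / 2) * \<tau>)) * (?t \<circ> (\<lambda>m. (m, l))) m) summable_on exponents l"
    by (rule summable_on_cmult_right)
  also have "(\<lambda>m. ee (- (of_real (bf G l l / 2) * \<tau>)) * (?t \<circ> (\<lambda>m. (m, l))) m) =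
      (\<lambda>m. f m l * ee (of_real (m - bf G l l / 2) * \<tau>))"
  proof
    fix m
    have "ee (of_real (m - bf G l l / 2) * \<tau>) = ee (- (of_real (bf G l l / 2) * \<tau>)) * ee (of_real m * \<tau>)"
      unfolding ee_add[symmetric] by (simp add: algebra_simps)
    then show "ee (- (of_real (bf G l l / 2) * \<tau>)) * (?t \<circ> (\<lambda>m. (m, l))) m = f m l * ee (of_real (m - bf G l l / 2) * \<tau>)"
      by simp
  qed
  finally show ?thesis unfolding theta_coeff_def by (rule has_sum_infsum)
qed

lemma theta_expansion:
  assumes \<tau>: "Im \<tau> > 0"
  shows "((\<lambda>l. theta_coeff l \<tau> * ee (of_real (bf G l l / 2) * \<tau> + bf G (rvec l) z)) has_sum \<phi> \<tau> z) (shadow G)"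
proof -
  let ?t = "\<lambda>(m, l). f m l * ee (of_real m * \<tau>) * ee (bf G (rvec l) z)"
  have bij: "bij_betw (\<lambda>(l, m). (m, l)) (Sigma (shadow G) exponents) (fourier_index G D)"
    by (rule bij_betw_byWitness[where f'="\<lambda>(m, l). (l, m)"])
       (auto simp: exponents_def fourier_index_def)
  have "((\<lambda>x. ?t (case x of (l, m) \<Rightarrow> (m, l))) has_sum \<phi> \<tau> z) (Sigma (shadow G) exponents)"
    using has_sum_reindex_bij_betw[OF bij, of ?t] fourier[OF \<tau>, of z] by blast
  then show ?thesis
  proof (rule has_sum_SigmaD)
    fix l assume l: "l \<in> shadow G"
    have "((\<lambda>m. f m l * ee (of_real (m - bf G l l / 2) * \<tau>) * ee (of_real (bf G l l / 2) * \<tau> + bf G (rvec l) z)) has_sum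
       theta_coeff l \<tau> * ee (of_real (bf G l l / 2) * \<tau> + bf G (rvec l) z)) (exponents l)"
      by (intro has_sum_cmult_left theta_coeff_has_sum l \<tau>)
    then show "((\<lambda>m. ?t (case (l, m) of (l, m) \<Rightarrow> (m, l))) has_sum
       theta_coeff l \<tau> * ee (of_real (bf G l l / 2) * \<tau> + bf G (rvec l) z)) (exponents l)"
      by (simp add: ee_add ee_diff left_diff_distrib mult.assoc)
  qed
qed

text \<open>By completing the square, the exponential of l at z + \<tau> p is, up to a factor common
  to all l, the exponential of l + p at z. Comparing coefficients in the exponential series in z
  gives the claim. The sign has modulus 1, so |h_l| depends only on the class of l modulo the
  lattice.\<close>

lemma theta_coeff_shift:
  assumes l: "l \<in> shadow G" and \<tau>: "Im \<tau> > 0"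
  shows "theta_coeff (l + ivec p) \<tau> = (-1) ^ nat (bf G p p) * theta_coeff l \<tau>"
proof -
  define s :: complex where "s = (-1) ^ nat (bf G p p)"
  let ?Q = "\<lambda>l. complex_of_real (bf G l l / 2) * \<tau>"
  define a where "a = (\<lambda>l. (theta_coeff l \<tau> - s * theta_coeff (l - ivec p) \<tau>) * ee (?Q l))"
  have s2: "s * s = 1" by (simp add: s_def flip: power_mult_distrib)
  have bij: "bij_betw (\<lambda>l. l + ivec p) (shadow G) (shadow G)"
    by (rule bij_betw_byWitness[where f'="\<lambda>l. l + ivec (- p)"])
       (use shadow_add_ivec[of _ p] shadow_add_ivec[of _ "- p"] in \<open>auto simp: ivec_minus\<close>)
  have main: "((\<lambda>l. a l * ee (bf G (rvec l) (rvec y))) has_sum 0) (shadow G)" for y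
  proof -
    let ?c = "ee (of_int (bf G p p) * \<tau> / 2 + bf G (ivec p) (rvec y))"
    let ?u = "\<lambda>l. s * theta_coeff (l - ivec p) \<tau> * ee (?Q l + bf G (rvec l) (rvec y))"
    have "((\<lambda>l. s * ?c * (theta_coeff l \<tau> * ee (?Q l + bf G (rvec l) (rvec y + \<tau> *s ivec p)))) has_sum
       s * ?c * \<phi> \<tau> (rvec y + \<tau> *s ivec p)) (shadow G)"
      by (intro has_sum_cmult_right theta_expansion \<tau>)
    also have "s * ?c * \<phi> \<tau> (rvec y + \<tau> *s ivec p) = \<phi> \<tau> (rvec y)"
    proof -
      have "s * ?c * \<phi> \<tau> (rvec y + \<tau> *s ivec p) = (s * s) * (?c * inverse ?c) * \<phi> \<tau> (rvec y)"
        unfolding shift[OF \<tau>] s_def[symmetric] ee_minus by (simp only: mult_ac)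
      then show ?thesis by (simp add: s2)
    qed
    also have "(\<lambda>l. s * ?c * (theta_coeff l \<tau> * ee (?Q l + bf G (rvec l) (rvec y + \<tau> *s ivec p)))) =
      (\<lambda>l. ?u (l + ivec p))"
    proof
      fix l
      have "?Q (l + ivec p) = ?Q l + bf G (rvec l) (ivec p) * \<tau> + of_int (bf G p p) * \<tau> / 2"
        using bf_rvec[of G l "ivec p"] bf_sym[of "ivec p" l]
        by (simp add: bf_linear bf_ivec algebra_simps add_divide_distrib)
      then have "?Q (l + ivec p) + bf G (rvec (l + ivec p)) (rvec y) =
          (of_int (bf G p p) * \<tau> / 2 + bf G (ivec p) (rvec y)) + (?Q l + bf G (rvec l) (rvec y + \<tau> *s ivec p))"
        by (simp add: bf_linear rvec_add algebra_simps)
      then show "s * ?c * (theta_coeff l \<tau> * ee (?Q l + bf G (rvec l) (rvec y + \<tau> *s ivec p))) = ?u (l + ivec p)"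
        by (simp only: ee_add add_diff_cancel_right' mult_ac)
    qed
    finally have "(?u has_sum \<phi> \<tau> (rvec y)) (shadow G)"
      using has_sum_reindex_bij_betw[OF bij, of ?u] by blast
    from has_sum_add[OF theta_expansion[OF \<tau>, of "rvec y"] has_sum_uminusI[OF this]]
    show ?thesis by (simp add: a_def ee_add algebra_simps)
  qed
  have "(a has_sum 0) {k\<in>shadow G. (2 * pi) *\<^sub>R gvec G k = (2 * pi) *\<^sub>R gvec G (l + ivec p)}"
  proof (rule has_sum_exponentials_frequency)
    show "a summable_on shadow G"
      using has_sum_imp_summable[OF main[of 0]] by simp
    fix y
    show "((\<lambda>k. a k * exp (\<i> * complex_of_real (((2 * pi) *\<^sub>R gvec G k) \<bullet> y))) has_sum 0) (shadow G)"
      using main[of y] by (simp add: bf_rvec bf_gvec ee_def mult_ac)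
  qed
  also have "{k\<in>shadow G. (2 * pi) *\<^sub>R gvec G k = (2 * pi) *\<^sub>R gvec G (l + ivec p)} = {l + ivec p}"
    using shadow_add_ivec[OF l] by (auto simp: gvec_inj)
  finally have "a (l + ivec p) = 0"
    by (simp add: has_sum_finite_iff)
  then show ?thesis by (simp add: a_def s_def)
qed

text \<open>In real torus coordinates z = x \<tau> + y the factor e(\<tau>(x,x)/2) absorbs the
  exponential of the inversion up to a phase, leaving only |\<epsilon>|^2 and a power of
  |\<tau>|.\<close>

definition W :: "complex \<Rightarrow> real^'n \<Rightarrow> real^'n \<Rightarrow> real" where
  "W \<tau> x y = (norm (ee (of_real (bf G x x / 2) * \<tau>) * \<phi> \<tau> (\<tau> *s rvec x + rvec y)))\<^sup>2"

text \<open>With z = \<tau> y - x one has (z,z)/(2\<tau>) - (x,x)/(2\<tau>) = \<tau>(y,y)/2 - (x,y),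
  and the real number (x,y) contributes only a phase. The torus coordinates are rotated from (x, y)
  to (y, -x); squaring the norm turns \<open>csqrt \<tau>\<close> into |\<tau>|.\<close>

lemma W_inversion_aux:
  assumes \<tau>: "Im \<tau> > 0"
  shows "W (- 1 / \<tau>) x y = (norm \<epsilon>)\<^sup>2 * norm \<tau> ^ CARD('n) * W \<tau> y (- x)"
proof -
  have \<tau>0: "\<tau> \<noteq> 0" using \<tau> by auto
  define z where "z = \<tau> *s rvec y + rvec (- x)"
  have "(- 1 / \<tau>) *s rvec x + rvec y = (1 / \<tau>) *s z"
    using \<tau>0 by (simp add: z_def vec_eq_iff rvec_def field_simps)
  then have 1: "\<phi> (- 1 / \<tau>) ((- 1 / \<tau>) *s rvec x + rvec y) = \<epsilon> * csqrt \<tau> ^ CARD('n) * ee (bf G z z / (2 * \<tau>)) * \<phi> \<tau> z"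
    using inversion[OF \<tau>, of z] by simp
  have zz: "bf G z z = \<tau> * \<tau> * of_real (bf G y y) - 2 * \<tau> * of_real (bf G x y) + of_real (bf G x x)"
    using bf_sym[of y x] by (simp add: z_def bf_linear bf_rvec rvec_minus algebra_simps)
  have "bf G z z / (2 * \<tau>) + of_real (bf G x x / 2) * (- 1 / \<tau>) = of_real (bf G y y / 2) * \<tau> + of_real (- bf G x y)"
    unfolding zz using \<tau>0 by (simp add: field_simps)
  then have "ee (of_real (bf G x x / 2) * (- 1 / \<tau>)) * ee (bf G z z / (2 * \<tau>)) =
      ee (of_real (bf G y y / 2) * \<tau>) * ee (of_real (- bf G x y))"
    by (simp only: ee_add[symmetric] add.commute)
  moreover have "norm (ee (of_real (- bf G x y))) = 1" by (simp add: norm_ee)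
  ultimately have 2: "norm (ee (of_real (bf G x x / 2) * (- 1 / \<tau>))) * norm (ee (bf G z z / (2 * \<tau>))) = norm (ee (of_real (bf G y y / 2) * \<tau>))"
    by (metis norm_mult mult.right_neutral)
  have 3: "(norm (csqrt \<tau> ^ CARD('n)))\<^sup>2 = norm \<tau> ^ CARD('n)"
  proof -
    have "(norm (csqrt \<tau> ^ CARD('n)))\<^sup>2 = norm ((csqrt \<tau>)\<^sup>2) ^ CARD('n)"
      by (simp only: norm_power power_mult[symmetric] mult.commute)
    then show ?thesis by simp
  qed
  have "W (- 1 / \<tau>) x y = (norm \<epsilon>)\<^sup>2 * (norm (csqrt \<tau> ^ CARD('n)))\<^sup>2 *
      (norm (ee (of_real (bf G x x / 2) * (- 1 / \<tau>))) * norm (ee (bf G z z / (2 * \<tau>))) * norm (\<phi> \<tau> z))\<^sup>2"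
    unfolding W_def 1 by (simp only: norm_mult power_mult_distrib mult_ac)
  then show ?thesis unfolding 2 3 by (simp add: W_def z_def norm_mult)
qed

text \<open>The square of the inversion is \<open>z \<mapsto> -z\<close>, so applying it four times yields \<open>|\<epsilon>|\<^sup>8 = 1\<close>. Hence
  nothing has to be known about the eta function, not even that \<open>v_eta\<close> is not a junk value.\<close>

lemma norm_multiplier: "norm \<epsilon> = 1"
proof -
  obtain \<tau> z where \<tau>: "Im \<tau> > 0" and nz: "\<phi> \<tau> z \<noteq> 0" using nonzero by blast
  define x :: "real^'n" where "x = (\<chi> i. Im (z$i) / Im \<tau>)"
  define y :: "real^'n" where "y = (\<chi> i. Re (z$i) - x$i * Re \<tau>)"
  have z: "z = \<tau> *s rvec x + rvec y"
    using \<tau> by (simp add: vec_eq_iff rvec_def x_def y_def complex_eq_iff)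
  have W: "W \<tau> x y \<noteq> 0" using nz by (simp add: W_def z[symmetric])
  have \<tau>': "Im (- 1 / \<tau>) > 0" using \<tau> by (rule Im_minus_inverse_pos)
  have \<tau>0: "\<tau> \<noteq> 0" using \<tau> by auto
  have "W \<tau> a b = (norm \<epsilon>)^4 * W \<tau> (- a) (- b)" for a b
  proof -
    have "W (- 1 / (- 1 / \<tau>)) a b = (norm \<epsilon>)\<^sup>2 * norm (- 1 / \<tau>) ^ CARD('n) * ((norm \<epsilon>)\<^sup>2 * norm \<tau> ^ CARD('n) * W \<tau> (- a) (- b))"
      unfolding W_inversion_aux[OF \<tau>'] W_inversion_aux[OF \<tau>] ..
    also have "\<dots> = (norm \<epsilon>)^4 * (norm (- 1 / \<tau>) * norm \<tau>) ^ CARD('n) * W \<tau> (- a) (- b)"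
      by (simp add: power_mult_distrib power4_eq_xxxx power2_eq_square mult_ac)
    also have "norm (- 1 / \<tau>) * norm \<tau> = 1" using \<tau>0 by (simp add: norm_divide)
    finally show ?thesis using \<tau>0 by simp
  qed
  from this[of x y] this[of "- x" "- y"] have "W \<tau> x y = (norm \<epsilon>)^8 * W \<tau> x y"
    by (simp add: power_add[symmetric] mult.assoc[symmetric])
  then have "(norm \<epsilon>)^8 = 1" using W by simp
  then show ?thesis using power_eq_imp_eq_base[of "norm \<epsilon>" 8 1] by simp
qed

lemma W_inversion: "Im \<tau> > 0 \<Longrightarrow> W (- 1 / \<tau>) x y = norm \<tau> ^ CARD('n) * W \<tau> y (- x)"
  using W_inversion_aux by (simp add: norm_multiplier)

end

section \<open>Integration over the torus\<close>

text \<open>\<open>has_sum\<close> is a limit along the filter of finite subsets; an enumeration of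
  the countable index set turns it into the limit of a sequence, which preserves measurability.
  Padding with 0 treats finite and infinite \<open>K\<close> alike.\<close>

lemma borel_measurable_has_sum:
  fixes t :: "'k \<Rightarrow> 'w \<Rightarrow> complex"
  assumes K: "countable K" and t: "\<And>k. k \<in> K \<Longrightarrow> t k \<in> borel_measurable M"
    and sum: "\<And>w. w \<in> space M \<Longrightarrow> ((\<lambda>k. t k w) has_sum \<Phi> w) K"
  shows "\<Phi> \<in> borel_measurable M"
proof -
  define g where "g = (\<lambda>n w. if n \<in> to_nat_on K ` K then t (from_nat_into K n) w else 0)"
  have g_meas: "g n \<in> borel_measurable M" for n
    using t K by (cases "n \<in> to_nat_on K ` K") (auto simp: g_def)
  show ?thesis
  proof (rule borel_measurable_LIMSEQ_metric)
    show "(\<lambda>w. \<Sum>i<n. g i w) \<in> borel_measurable M" for n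
      using g_meas by (intro borel_measurable_sum) auto
    fix w assume w: "w \<in> space M"
    have "((\<lambda>n. t (from_nat_into K n) w) has_sum \<Phi> w) (to_nat_on K ` K)"
      unfolding has_sum_reindex[OF inj_on_to_nat_on[OF K]]
      by (rule has_sum_cong[THEN iffD1, OF _ sum[OF w]]) (simp add: K)
    then have "((\<lambda>n. g n w) has_sum \<Phi> w) UNIV"
      by (rule has_sum_cong_neutral[THEN iffD1, rotated -1]) (auto simp: g_def)
    then show "(\<lambda>n. \<Sum>i<n. g i w) \<longlonglongrightarrow> \<Phi> w"
      using has_sum_imp_sums by (simp add: sums_def)
  qed
qed

lemma nn_integral_lborel_affine:
  fixes g :: "'a::euclidean_space \<Rightarrow> ennreal"
  assumes [measurable]: "g \<in> borel_measurable borel" and c: "c \<noteq> 0"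
  shows "(\<integral>\<^sup>+x. g x \<partial>lborel) = ennreal (\<bar>c\<bar> ^ DIM('a)) * (\<integral>\<^sup>+x. g (t + c *\<^sub>R x) \<partial>lborel)"
  by (subst lborel_affine[OF c, of t]) (simp add: nn_integral_density nn_integral_distr nn_integral_cmult)

text \<open>After a translation Tonelli moves the sum inside the integral, and x - p lies in the
  cube for exactly one p, the vector of floors of x.\<close>

lemma nn_integral_unit_cube_translates:
  fixes g :: "real^'n \<Rightarrow> ennreal"
  assumes [measurable]: "g \<in> borel_measurable borel"
  shows "(\<integral>\<^sup>+p. (\<integral>\<^sup>+x. g (x + ivec p) * indicator unit_cube x \<partial>lborel) \<partial>count_space (UNIV :: (int^'n) set)) = (\<integral>\<^sup>+x. g x \<partial>lborel)"
proof -
  have "(\<integral>\<^sup>+x. g (x + ivec p) * indicator unit_cube x \<partial>lborel) = (\<integral>\<^sup>+x. g x * indicator unit_cube (x - ivec p) \<partial>lborel)" for p :: "int^'n"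
    using nn_integral_lborel_affine[of "\<lambda>x. g x * indicator unit_cube (x - ivec p)" 1 "ivec p"]
    by (simp add: add.commute)
  then have "(\<integral>\<^sup>+p. (\<integral>\<^sup>+x. g (x + ivec p) * indicator unit_cube x \<partial>lborel) \<partial>count_space (UNIV :: (int^'n) set)) =
     (\<integral>\<^sup>+p. (\<integral>\<^sup>+x. g x * indicator unit_cube (x - ivec p) \<partial>lborel) \<partial>count_space (UNIV :: (int^'n) set))"
    by simp
  also have "\<dots> = (\<integral>\<^sup>+x. (\<integral>\<^sup>+p. g x * indicator unit_cube (x - ivec p) \<partial>count_space (UNIV :: (int^'n) set)) \<partial>lborel)"
    by (rule nn_integral_count_space_nn_integral[symmetric]) (auto simp: countable_UNIV_int_vec)
  also have "\<dots> = (\<integral>\<^sup>+x. g x \<partial>lborel)"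
  proof (rule nn_integral_cong)
    fix x :: "real^'n"
    have iff: "x - ivec p \<in> unit_cube \<longleftrightarrow> p = (\<chi> i. \<lfloor>x$i\<rfloor>)" for p
      by (auto simp: unit_cube_def ivec_def vec_eq_iff floor_eq_iff eq_commute[of "p $ _"] algebra_simps)
    have "(\<integral>\<^sup>+p. g x * indicator unit_cube (x - ivec p) \<partial>count_space UNIV) = (\<Sum>p\<in>{\<chi> i. \<lfloor>x$i\<rfloor>}. g x * indicator unit_cube (x - ivec p))"
      by (rule nn_integral_count_space') (auto simp: iff)
    also have "\<dots> = g x" by (simp add: iff)
    finally show "(\<integral>\<^sup>+p. g x * indicator unit_cube (x - ivec p) \<partial>count_space UNIV) = g x" .
  qed
  finally show ?thesis .
qed

section \<open>Gaussian integrals\<close>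

lemma nn_integral_gaussian_finite:
  assumes "c > 0"
  shows "(\<integral>\<^sup>+t. ennreal (exp (- c * t\<^sup>2)) \<partial>lborel) < \<infinity>"
proof -
  \<comment> \<open>1/(4c) is the maximum of |t| - c t^2, so the Gaussian is dominated by
    \<open>B\<close> exp(-|t|).\<close>
  define B where "B = exp (1 / (4 * c))"
  define E where "E = (\<integral>\<^sup>+t. ennreal (exp (- t)) * indicator {0..} t \<partial>lborel)"
  have "E = ennreal (0 - (- exp (- 0)))"
    unfolding E_def
  proof (rule nn_integral_FTC_atLeast)
    show "((\<lambda>t::real. - exp (- t)) \<longlongrightarrow> 0) at_top"
      using tendsto_minus[OF filterlim_compose[OF exp_at_bot filterlim_uminus_at_bot_at_top]] by simp
  qed (auto intro!: derivative_eq_intros)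
  then have E: "E < \<infinity>" by simp
  have E': "(\<integral>\<^sup>+t. ennreal (exp t) * indicator {..0} t \<partial>lborel) = E"
    unfolding E_def
    by (subst nn_integral_real_affine[of _ "-1" 0]) (auto intro!: nn_integral_cong simp: indicator_def)
  have "(\<integral>\<^sup>+t. ennreal (exp (- c * t\<^sup>2)) \<partial>lborel) \<le>
      (\<integral>\<^sup>+t. ennreal B * (ennreal (exp (- t)) * indicator {0..} t + ennreal (exp t) * indicator {..0} t) \<partial>lborel)"
  proof (rule nn_integral_mono)
    fix t :: real
    have "- c * t\<^sup>2 \<le> 1 / (4 * c) - \<bar>t\<bar>"
    proof -
      have "0 \<le> (2 * c * \<bar>t\<bar> - 1)\<^sup>2" by simp
      also have "(2 * c * \<bar>t\<bar> - 1)\<^sup>2 = 4 * c * (c * t\<^sup>2 - \<bar>t\<bar> + 1 / (4 * c))"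
        using assms by (simp add: power2_diff field_simps power2_eq_square)
      finally have "0 \<le> c * t\<^sup>2 - \<bar>t\<bar> + 1 / (4 * c)" using assms by (simp add: zero_le_mult_iff)
      then show ?thesis by simp
    qed
    then have "exp (- c * t\<^sup>2) \<le> B * exp (- \<bar>t\<bar>)"
      unfolding B_def exp_add[symmetric] by simp
    then have "ennreal (exp (- c * t\<^sup>2)) \<le> ennreal B * ennreal (exp (- \<bar>t\<bar>))"
      by (simp add: B_def ennreal_mult[symmetric] ennreal_leI)
    also have "\<dots> \<le> ennreal B * (ennreal (exp (- t)) * indicator {0..} t + ennreal (exp t) * indicator {..0} t)"
      by (intro mult_left_mono) (auto simp: indicator_def)
    finally show "ennreal (exp (- c * t\<^sup>2)) \<le> \<dots>" .
  qed
  also have "\<dots> = ennreal B * (E + E)"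
    by (subst nn_integral_cmult, measurable) (simp add: nn_integral_add E' E_def[symmetric])
  also have "\<dots> < \<infinity>" using E by (simp add: ennreal_mult_less_top)
  finally show ?thesis .
qed

context lattice_form
begin

text \<open>This is |e(\<tau>(x,x)/2)|^2 for Im \<tau> = v.\<close>

definition gauss :: "real \<Rightarrow> real^'n \<Rightarrow> real" where
  "gauss v x = exp (- 2 * pi * v * bf G x x)"

lemma gauss_pos: "gauss v x > 0"
  by (simp add: gauss_def)

definition gauss_int :: "real \<Rightarrow> ennreal" where
  "gauss_int v = (\<integral>\<^sup>+(x::real^'n). ennreal (gauss v x) \<partial>lborel)"

lemma gauss_measurable [measurable]: "gauss v \<in> borel_measurable borel"
  unfolding gauss_def by (intro borel_measurable_continuous_onI continuous_intros)

lemma gauss_int_finite: "v > 0 \<Longrightarrow> gauss_int v < \<infinity>"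
proof -
  assume v: "v > 0"
  obtain \<epsilon> where \<epsilon>: "\<epsilon> > 0" "\<And>x::real^'n. bf G x x \<ge> \<epsilon> * (x \<bullet> x)" using bf_coercive by blast
  define c where "c = 2 * pi * v * \<epsilon>"
  have c: "c > 0" using v \<epsilon> by (simp add: c_def)
  have "gauss_int v \<le> (\<integral>\<^sup>+(x::real^'n). (\<Prod>b\<in>Basis. ennreal (exp (- c * (x \<bullet> b)\<^sup>2))) \<partial>lborel)"
    unfolding gauss_int_def
  proof (rule nn_integral_mono)
    fix x :: "real^'n"
    have "(\<Prod>b\<in>Basis. exp (- c * (x \<bullet> b)\<^sup>2)) = exp (- c * (x \<bullet> x))"
      by (subst euclidean_inner[of x x]) (simp add: exp_sum[symmetric] sum_distrib_left power2_eq_square sum_negf)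
    moreover have "- 2 * pi * v * bf G x x \<le> - c * (x \<bullet> x)"
    proof -
      have "2 * pi * v * (\<epsilon> * (x \<bullet> x)) \<le> 2 * pi * v * bf G x x"
        using v \<epsilon>(2)[of x] by (intro mult_left_mono) auto
      then show ?thesis by (simp add: c_def mult_ac)
    qed
    ultimately show "ennreal (gauss v x) \<le> (\<Prod>b\<in>Basis. ennreal (exp (- c * (x \<bullet> b)\<^sup>2)))"
      unfolding gauss_def by (subst prod_ennreal) (auto intro!: ennreal_leI)
  qed
  also have "\<dots> = (\<Prod>b\<in>(Basis :: (real^'n) set). (\<integral>\<^sup>+t. ennreal (exp (- c * t\<^sup>2)) \<partial>lborel))"
    by (rule nn_integral_lborel_prod) auto
  also have "\<dots> < \<infinity>"
    using nn_integral_gaussian_finite[OF c] by (simp add: power_less_top_ennreal)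
  finally show ?thesis .
qed

lemma gauss_int_pos: "gauss_int v \<noteq> 0"
proof
  assume "gauss_int v = 0"
  then have "AE x::real^'n in lborel. ennreal (gauss v x) = 0"
    unfolding gauss_int_def by (subst (asm) nn_integral_0_iff_AE) auto
  then have "AE x::real^'n in lborel. False"
    by (rule eventually_mono) (metis ennreal_eq_0_iff gauss_pos not_le)
  then show False by (simp add: eventually_False ae_filter_eq_bot_iff)
qed

text \<open>Substitution of r x for x. With r = |\<tau>| and v = Im \<tau> the left side belongs to
  -1/\<tau>, and the power of r is the squared modulus of the automorphy factor of singular
  weight.\<close>

lemma gauss_int_scale:
  assumes "r > 0"
  shows "gauss_int (v / r\<^sup>2) = ennreal (r ^ CARD('n)) * gauss_int v"
proof -
  have "gauss_int (v / r\<^sup>2) = ennreal (r ^ CARD('n)) * (\<integral>\<^sup>+(x::real^'n). ennreal (gauss (v / r\<^sup>2) (0 + r *\<^sub>R x)) \<partial>lborel)"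
    unfolding gauss_int_def using assms by (subst nn_integral_lborel_affine[of _ r 0]) auto
  also have "\<dots> = ennreal (r ^ CARD('n)) * gauss_int v"
  proof -
    have "gauss (v / r\<^sup>2) (0 + r *\<^sub>R x) = gauss v x" for x
      using assms by (simp add: gauss_def bf_linear power2_eq_square)
    then show ?thesis by (simp only: gauss_int_def)
  qed
  finally show ?thesis .
qed

end

context singular_form
begin

definition mass :: "complex \<Rightarrow> real" where
  "mass \<tau> = (\<Sum>\<mu>\<in>shadow G \<inter> unit_cube. (norm (theta_coeff \<mu> \<tau>))\<^sup>2)"

definition W_root :: "complex \<Rightarrow> real^'n \<Rightarrow> real^'n \<Rightarrow> complex" where
  "W_root \<tau> x y = ee (of_real (bf G x x / 2) * \<tau>) * \<phi> \<tau> (\<tau> *s rvec x + rvec y)"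

text \<open>Since (x,x)/2 + (l,x) + (l,l)/2 = (l+x,l+x)/2, for fixed x this is a Fourier series in y
  with frequencies \<open>gvec G l\<close>. Parseval then applies, and each squared coefficient is
  |h_l|^2 times a Gaussian in x + l.\<close>

lemma W_root_expansion:
  assumes \<tau>: "Im \<tau> > 0"
  shows "((\<lambda>l. theta_coeff l \<tau> * ee (of_real (bf G (l + x) (l + x) / 2) * \<tau>) * ee (of_real (bf G l y))) has_sum W_root \<tau> x y) (shadow G)"
proof -
  have "((\<lambda>l. ee (of_real (bf G x x / 2) * \<tau>) * (theta_coeff l \<tau> * ee (of_real (bf G l l / 2) * \<tau> + bf G (rvec l) (\<tau> *s rvec x + rvec y))))
     has_sum W_root \<tau> x y) (shadow G)"
    unfolding W_root_def by (intro has_sum_cmult_right theta_expansion \<tau>)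
  also have "(\<lambda>l. ee (of_real (bf G x x / 2) * \<tau>) * (theta_coeff l \<tau> * ee (of_real (bf G l l / 2) * \<tau> + bf G (rvec l) (\<tau> *s rvec x + rvec y)))) =
     (\<lambda>l. theta_coeff l \<tau> * ee (of_real (bf G (l + x) (l + x) / 2) * \<tau>) * ee (of_real (bf G l y)))"
  proof
    fix l
    have eq: "of_real (bf G x x / 2) * \<tau> + (of_real (bf G l l / 2) * \<tau> + bf G (rvec l) (\<tau> *s rvec x + rvec y)) =
      of_real (bf G (l + x) (l + x) / 2) * \<tau> + of_real (bf G l y)"
      using bf_sym[of x l] by (simp add: bf_linear bf_rvec algebra_simps add_divide_distrib)
    have "ee (of_real (bf G x x / 2) * \<tau>) * (theta_coeff l \<tau> * ee (of_real (bf G l l / 2) * \<tau> + bf G (rvec l) (\<tau> *s rvec x + rvec y))) =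
      theta_coeff l \<tau> * ee (of_real (bf G x x / 2) * \<tau> + (of_real (bf G l l / 2) * \<tau> + bf G (rvec l) (\<tau> *s rvec x + rvec y)))"
      by (simp only: ee_add mult_ac)
    then show "ee (of_real (bf G x x / 2) * \<tau>) * (theta_coeff l \<tau> * ee (of_real (bf G l l / 2) * \<tau> + bf G (rvec l) (\<tau> *s rvec x + rvec y))) =
      theta_coeff l \<tau> * ee (of_real (bf G (l + x) (l + x) / 2) * \<tau>) * ee (of_real (bf G l y))"
      by (simp only: eq ee_add[of "of_real (bf G (l + x) (l + x) / 2) * \<tau>"] mult.assoc)
  qed
  finally show ?thesis .
qed

lemma W_eq: "W \<tau> x y = (norm (W_root \<tau> x y))\<^sup>2"
  by (simp add: W_def W_root_def)

lemma W_nonneg: "W \<tau> x y \<ge> 0"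
  by (simp add: W_def)

lemma norm_theta_term:
  "(norm (theta_coeff l \<tau> * ee (of_real (bf G (l + x) (l + x) / 2) * \<tau>)))\<^sup>2 =
   (norm (theta_coeff l \<tau>))\<^sup>2 * gauss (Im \<tau>) (x + l)"
  by (simp add: gauss_def norm_mult norm_ee power_mult_distrib exp_double[symmetric] add.commute mult_ac)

text \<open>Parseval in the variable y. The sign \<open>s\<close> is carried along because the
  inversion produces \<open>W \<tau> y (- x)\<close>, and -1 maps the half-open cube to a different
  one; putting the sign into the frequencies avoids moving the domain.\<close>

lemma nn_integral_W:
  assumes \<tau>: "Im \<tau> > 0" and s: "s \<in> {1, -1}"
  shows "(\<integral>\<^sup>+y. ennreal (W \<tau> x (s *\<^sub>R y)) * indicator unit_cube y \<partial>lborel) =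
    (\<integral>\<^sup>+l. ennreal ((norm (theta_coeff l \<tau>))\<^sup>2) * ennreal (gauss (Im \<tau>) (x + l)) \<partial>count_space (shadow G))"
proof -
  let ?a = "\<lambda>l. theta_coeff l \<tau> * ee (of_real (bf G (l + x) (l + x) / 2) * \<tau>)"
  have "(\<integral>\<^sup>+y. ennreal ((norm (W_root \<tau> x (s *\<^sub>R y)))\<^sup>2) * indicator unit_cube y \<partial>lborel) =
    (\<integral>\<^sup>+l. ennreal ((norm (?a l))\<^sup>2) \<partial>count_space (shadow G))"
  proof (rule parseval_unit_cube[where \<omega>="\<lambda>l. s *\<^sub>R gvec G l"])
    show "?a summable_on shadow G"
      using has_sum_imp_summable[OF W_root_expansion[OF \<tau>, of x 0]] by simp
    show "inj_on (\<lambda>l. s *\<^sub>R gvec G l) (shadow G)"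
      using s by (auto simp: inj_on_def gvec_inj)
    show "\<exists>p::int^'n. s *\<^sub>R gvec G j - s *\<^sub>R gvec G k = ivec p" if jk: "j \<in> shadow G" "k \<in> shadow G" for j k
    proof -
      obtain p :: "int^'n" where p: "gvec G j - gvec G k = ivec p" using shadow_diff_int[OF jk] by blast
      show ?thesis
      proof (cases "s = 1")
        case True then show ?thesis using p by auto
      next
        case False
        then have "s *\<^sub>R gvec G j - s *\<^sub>R gvec G k = ivec (- p)"
          using s by (simp add: ivec_minus flip: p)
        then show ?thesis by blast
      qed
    qed
    show "((\<lambda>l. ?a l * exp (2 * pi * \<i> * complex_of_real ((s *\<^sub>R gvec G l) \<bullet> y))) has_sum W_root \<tau> x (s *\<^sub>R y)) (shadow G)" for y
      using W_root_expansion[OF \<tau>, of x "s *\<^sub>R y"] by (simp add: bf_gvec ee_def)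
  qed
  then show ?thesis unfolding W_eq norm_theta_term by (simp add: ennreal_mult gauss_pos less_imp_le)
qed

text \<open>Unfolding: with l = \<mu> + p, the coefficient has constant modulus along p, and the
  integrals over all translates of the cube add up to the Gaussian integral over the whole space,
  once for each class \<mu>.\<close>

lemma nn_integral_theta_mass:
  assumes \<tau>: "Im \<tau> > 0"
  shows "(\<integral>\<^sup>+x. (\<integral>\<^sup>+l. ennreal ((norm (theta_coeff l \<tau>))\<^sup>2) * ennreal (gauss (Im \<tau>) (x + l)) \<partial>count_space (shadow G)) * indicator unit_cube x \<partial>lborel) =
    ennreal (mass \<tau>) * gauss_int (Im \<tau>)"
proof -
  let ?c = "\<lambda>l. ennreal ((norm (theta_coeff l \<tau>))\<^sup>2)"
  let ?g = "\<lambda>x::real^'n. ennreal (gauss (Im \<tau>) x)"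
  let ?F = "\<lambda>l. \<integral>\<^sup>+x. (?c l * ?g (x + l)) * indicator unit_cube x \<partial>lborel"
  have "(\<integral>\<^sup>+x. (\<integral>\<^sup>+l. ?c l * ?g (x + l) \<partial>count_space (shadow G)) * indicator unit_cube x \<partial>lborel) =
    (\<integral>\<^sup>+x. (\<integral>\<^sup>+l. (?c l * ?g (x + l)) * indicator unit_cube x \<partial>count_space (shadow G)) \<partial>lborel)"
    by (intro nn_integral_cong nn_integral_multc[symmetric]) auto
  also have "\<dots> = (\<integral>\<^sup>+l. ?F l \<partial>count_space (shadow G))"
  proof (rule nn_integral_count_space_nn_integral[OF countable_shadow])
    fix l
    have "(\<lambda>x. ?g (x + l)) \<in> borel_measurable borel"
      by measurable
    then show "(\<lambda>x. ?c l * ?g (x + l) * indicator unit_cube x) \<in> borel_measurable lborel" by auto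
  qed
  also have "\<dots> = (\<integral>\<^sup>+z. ?F ((\<lambda>(\<mu>, p). \<mu> + ivec p) z) \<partial>count_space ((shadow G \<inter> unit_cube) \<times> (UNIV :: (int^'n) set)))"
    by (rule nn_integral_bij_count_space[OF shadow_bij, symmetric])
  also have "\<dots> = (\<Sum>\<mu>\<in>shadow G \<inter> unit_cube. \<integral>\<^sup>+p. ?F (\<mu> + ivec p) \<partial>count_space (UNIV :: (int^'n) set))"
  proof -
    have cs: "count_space ((shadow G \<inter> unit_cube) \<times> (UNIV :: (int^'n) set)) =
       count_space (shadow G \<inter> unit_cube) \<Otimes>\<^sub>M count_space (UNIV :: (int^'n) set)"
      by (rule pair_measure_countable[symmetric]) (auto simp: countable_UNIV_int_vec countable_finite finite_shadow_cube)
    interpret sigma_finite_measure "count_space (UNIV :: (int^'n) set)"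
      by (rule sigma_finite_measure_count_space_countable) (rule countable_UNIV_int_vec)
    have "(\<integral>\<^sup>+z. ?F ((\<lambda>(\<mu>, p). \<mu> + ivec p) z) \<partial>count_space ((shadow G \<inter> unit_cube) \<times> (UNIV :: (int^'n) set))) =
      (\<integral>\<^sup>+\<mu>. (\<integral>\<^sup>+p. ?F ((\<lambda>(\<mu>, p). \<mu> + ivec p) (\<mu>, p)) \<partial>count_space (UNIV :: (int^'n) set)) \<partial>count_space (shadow G \<inter> unit_cube))"
      unfolding cs
      by (rule nn_integral_fst[symmetric]) (simp add: cs[symmetric])
    also have "\<dots> = (\<Sum>\<mu>\<in>shadow G \<inter> unit_cube. \<integral>\<^sup>+p. ?F (\<mu> + ivec p) \<partial>count_space (UNIV :: (int^'n) set))"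
      by (simp add: nn_integral_count_space_finite finite_shadow_cube)
    finally show ?thesis .
  qed
  also have "\<dots> = (\<Sum>\<mu>\<in>shadow G \<inter> unit_cube. ?c \<mu> * gauss_int (Im \<tau>))"
  proof (rule sum.cong[OF refl])
    fix \<mu> assume \<mu>: "\<mu> \<in> shadow G \<inter> unit_cube"
    have meas [measurable]: "(\<lambda>x. ?g (x + \<mu>)) \<in> borel_measurable borel"
      by measurable
    have "?c (\<mu> + ivec p) = ?c \<mu>" for p
      using \<mu> by (simp add: theta_coeff_shift \<tau> norm_mult norm_power)
    then have "(\<integral>\<^sup>+p. ?F (\<mu> + ivec p) \<partial>count_space (UNIV :: (int^'n) set)) =
       (\<integral>\<^sup>+p. (\<integral>\<^sup>+x. (\<lambda>x. ?c \<mu> * ?g (x + \<mu>)) (x + ivec p) * indicator unit_cube x \<partial>lborel) \<partial>count_space (UNIV :: (int^'n) set))"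
      by (simp add: add_ac)
    also have "\<dots> = (\<integral>\<^sup>+x. ?c \<mu> * ?g (x + \<mu>) \<partial>lborel)"
      by (rule nn_integral_unit_cube_translates) measurable
    also have "\<dots> = ?c \<mu> * (\<integral>\<^sup>+x. ?g (x + \<mu>) \<partial>lborel)"
      by (rule nn_integral_cmult) simp
    also have "(\<integral>\<^sup>+x. ?g (x + \<mu>) \<partial>lborel) = gauss_int (Im \<tau>)"
      unfolding gauss_int_def
      using nn_integral_lborel_affine[of "?g" 1 \<mu>] by (simp add: add.commute)
    finally show "(\<integral>\<^sup>+p. ?F (\<mu> + ivec p) \<partial>count_space (UNIV :: (int^'n) set)) = ?c \<mu> * gauss_int (Im \<tau>)" .
  qed
  also have "\<dots> = ennreal (mass \<tau>) * gauss_int (Im \<tau>)"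
    by (simp add: mass_def sum_distrib_right[symmetric])
  finally show ?thesis .
qed

text \<open>Tonelli needs joint measurability in x and y, which is inherited from the continuous
  terms of the expansion.\<close>

lemma W_measurable:
  assumes \<tau>: "Im \<tau> > 0"
  shows "(\<lambda>(x, y). ennreal (W \<tau> x (- y))) \<in> borel_measurable (lborel \<Otimes>\<^sub>M lborel)"
proof -
  have "(\<lambda>w. W_root \<tau> (fst w) (- snd w)) \<in> borel_measurable borel"
  proof (rule borel_measurable_has_sum[OF countable_shadow _ W_root_expansion[OF \<tau>]])
    fix l
    show "(\<lambda>w. theta_coeff l \<tau> * ee (of_real (bf G (l + fst w) (l + fst w) / 2) * \<tau>) * ee (of_real (bf G l (- snd w)))) \<in> borel_measurable borel"
      by (intro borel_measurable_continuous_onI continuous_intros) auto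
  qed
  then show ?thesis
    unfolding lborel_prod W_eq case_prod_beta by simp
qed

text \<open>\<open>W\<close> integrated over the torus is \<open>mass \<tau>\<close> times a Gaussian integral, and the inversion merely
  swaps the two torus variables; this replaces Poisson summation for the theta functions.\<close>

lemma mass_inversion:
  assumes \<tau>: "Im \<tau> > 0"
  shows "mass (- 1 / \<tau>) = mass \<tau>"
proof -
  let ?I = "indicator unit_cube :: real^'n \<Rightarrow> ennreal"
  let ?r = "norm \<tau> ^ CARD('n)"
  have \<tau>': "Im (- 1 / \<tau>) > 0" using \<tau> by (rule Im_minus_inverse_pos)
  have r: "norm \<tau> > 0" using \<tau> by auto
  have meas: "(\<lambda>(x, y). ennreal (W \<tau> x (- y)) * ?I x * ?I y) \<in> borel_measurable (lborel \<Otimes>\<^sub>M lborel)"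
    using W_measurable[OF \<tau>] by (simp add: case_prod_beta)
  have "ennreal (mass (- 1 / \<tau>)) * gauss_int (Im (- 1 / \<tau>)) =
      (\<integral>\<^sup>+x. (\<integral>\<^sup>+y. ennreal (W (- 1 / \<tau>) x (1 *\<^sub>R y)) * ?I y \<partial>lborel) * ?I x \<partial>lborel)"
    unfolding nn_integral_W[OF \<tau>' insertI1] nn_integral_theta_mass[OF \<tau>'] ..
  also have "\<dots> = (\<integral>\<^sup>+x. (\<integral>\<^sup>+y. ennreal ?r * (ennreal (W \<tau> y (- x)) * ?I y * ?I x) \<partial>lborel) \<partial>lborel)"
  proof (intro nn_integral_cong)
    fix x :: "real^'n"
    show "(\<integral>\<^sup>+y. ennreal (W (- 1 / \<tau>) x (1 *\<^sub>R y)) * ?I y \<partial>lborel) * ?I x =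
      (\<integral>\<^sup>+y. ennreal ?r * (ennreal (W \<tau> y (- x)) * ?I y * ?I x) \<partial>lborel)"
      unfolding W_inversion[OF \<tau>]
      by (cases "x \<in> unit_cube") (auto simp: ennreal_mult W_nonneg mult_ac intro!: nn_integral_cong)
  qed
  \<comment> \<open>Tonelli and a renaming: the rotated coordinates (y, -x) become (x, -y), the case
    \<open>s\<close> = -1 of \<open>nn_integral_W\<close>.\<close>
  also have "\<dots> = (\<integral>\<^sup>+x. (\<integral>\<^sup>+y. ennreal ?r * (ennreal (W \<tau> x (- y)) * ?I x * ?I y) \<partial>lborel) \<partial>lborel)"
  proof (rule lborel_pair.Fubini')
    show "(\<lambda>(x, y). ennreal ?r * (ennreal (W \<tau> x (- y)) * ?I x * ?I y)) \<in> borel_measurable (lborel \<Otimes>\<^sub>M lborel)"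
      using meas by (simp add: case_prod_beta)
  qed
  also have "\<dots> = (\<integral>\<^sup>+x. ennreal ?r * (\<integral>\<^sup>+y. ennreal (W \<tau> x (- y)) * ?I x * ?I y \<partial>lborel) \<partial>lborel)"
  proof (intro nn_integral_cong nn_integral_cmult)
    fix x :: "real^'n"
    show "(\<lambda>y. ennreal (W \<tau> x (- y)) * ?I x * ?I y) \<in> borel_measurable lborel"
      using measurable_compose_Pair1[OF _ meas, of x] by simp
  qed
  also have "\<dots> = ennreal ?r * (\<integral>\<^sup>+x. (\<integral>\<^sup>+y. ennreal (W \<tau> x (- y)) * ?I x * ?I y \<partial>lborel) \<partial>lborel)"
    using lborel.borel_measurable_nn_integral_fst[OF meas] by (intro nn_integral_cmult) simp
  also have "(\<integral>\<^sup>+x. (\<integral>\<^sup>+y. ennreal (W \<tau> x (- y)) * ?I x * ?I y \<partial>lborel) \<partial>lborel) =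
     (\<integral>\<^sup>+x. (\<integral>\<^sup>+y. ennreal (W \<tau> x ((- 1) *\<^sub>R y)) * ?I y \<partial>lborel) * ?I x \<partial>lborel)"
  proof (intro nn_integral_cong)
    fix x :: "real^'n"
    show "(\<integral>\<^sup>+y. ennreal (W \<tau> x (- y)) * ?I x * ?I y \<partial>lborel) = (\<integral>\<^sup>+y. ennreal (W \<tau> x ((- 1) *\<^sub>R y)) * ?I y \<partial>lborel) * ?I x"
      by (cases "x \<in> unit_cube") auto
  qed
  also have "\<dots> = ennreal (mass \<tau>) * gauss_int (Im \<tau>)"
    by (subst nn_integral_W[OF \<tau>]) (auto simp: nn_integral_theta_mass[OF \<tau>])
  \<comment> \<open>Here the singular weight pays off: |\<tau>|^rk is absorbed by the change of the
    Gaussian integral.\<close>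
  also have "ennreal ?r * (ennreal (mass \<tau>) * gauss_int (Im \<tau>)) = ennreal (mass \<tau>) * gauss_int (Im (- 1 / \<tau>))"
    unfolding Im_minus_inverse gauss_int_scale[OF r] by (simp add: mult_ac)
  finally have "ennreal (mass (- 1 / \<tau>)) = ennreal (mass \<tau>)"
    using gauss_int_pos gauss_int_finite[OF \<tau>'] 
    by (simp add: mult.commute[of "ennreal _"] ennreal_mult_cancel_left less_top[symmetric])
  then show ?thesis by (subst (asm) ennreal_inj) (auto simp: mass_def intro!: sum_nonneg)
qed

end

section \<open>Constancy of the theta coefficients\<close>

text \<open>Pairing with the value at the maximum point reduces this to the scalar maximum modulus
  principle.\<close>

lemma holomorphic_vector_maximum_constant:
  fixes h :: "'k \<Rightarrow> complex \<Rightarrow> complex"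
  assumes S: "open S" "connected S" and z0: "z0 \<in> S"
    and hol: "\<And>k. k \<in> R \<Longrightarrow> h k holomorphic_on S"
    and max: "\<And>z. z \<in> S \<Longrightarrow> (\<Sum>k\<in>R. (norm (h k z))\<^sup>2) \<le> (\<Sum>k\<in>R. (norm (h k z0))\<^sup>2)"
    and R: "finite R" and z: "z \<in> S" and k: "k \<in> R"
  shows "h k z = h k z0"
proof -
  define M where "M = (\<Sum>k\<in>R. (norm (h k z0))\<^sup>2)"
  define g where "g = (\<lambda>z. \<Sum>k\<in>R. cnj (h k z0) * h k z)"
  have g0: "g z0 = of_real M"
    by (simp add: g_def M_def complex_norm_square mult.commute del: of_real_power)
  have "g constant_on S"
  proof (rule maximum_modulus_principle[OF _ S S(1) order_refl z0])
    show "g holomorphic_on S" unfolding g_def by (intro holomorphic_intros hol)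
    fix w assume w: "w \<in> S"
    \<comment> \<open>In place of Cauchy-Schwarz: 2ab \<le> a^2 + b^2 in each coordinate, together
      with the maximality of \<open>M\<close>.\<close>
    have "2 * norm (g w) \<le> 2 * (\<Sum>k\<in>R. norm (h k z0) * norm (h k w))"
      unfolding g_def by (intro mult_left_mono order_trans[OF norm_sum] sum_mono) (auto simp: norm_mult)
    also have "\<dots> = (\<Sum>k\<in>R. 2 * norm (h k z0) * norm (h k w))"
      by (simp add: sum_distrib_left mult.assoc)
    also have "\<dots> \<le> (\<Sum>k\<in>R. (norm (h k z0))\<^sup>2 + (norm (h k w))\<^sup>2)"
      by (intro sum_mono sum_squares_bound)
    also have "\<dots> \<le> M + M"
      using max[OF w] by (simp add: sum.distrib M_def)
    finally have "norm (g w) \<le> M" by simp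
    also have "M \<le> norm (g z0)" unfolding g0 by simp
    finally show "norm (g w) \<le> norm (g z0)" .
  qed
  then have gz: "g z = of_real M"
    using z z0 g0 by (metis constant_on_def)
  \<comment> \<open>Once the pairing \<open>g\<close> is constantly \<open>M\<close>, the squared
    distance from h(z) to h(z0) is |h(z)|^2 + M - 2M, which is at most 0 by maximality.\<close>
  have "(norm (h k z - h k z0))\<^sup>2 = (norm (h k z))\<^sup>2 + (norm (h k z0))\<^sup>2 - 2 * Re (cnj (h k z0) * h k z)" for k
    unfolding cmod_power2 by (simp add: power2_eq_square algebra_simps)
  then have "(\<Sum>k\<in>R. (norm (h k z - h k z0))\<^sup>2) = (\<Sum>k\<in>R. (norm (h k z))\<^sup>2) + M - 2 * Re (g z)"
    by (simp add: sum.distrib sum_subtractf M_def g_def Re_sum sum_distrib_left)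
  also have "\<dots> \<le> 0" using max[OF z] by (simp add: gz M_def)
  finally have "(\<Sum>k\<in>R. (norm (h k z - h k z0))\<^sup>2) = 0"
    by (intro antisym sum_nonneg) auto
  then have "(norm (h k z - h k z0))\<^sup>2 = 0"
    using R k by (simp add: sum_nonneg_eq_0_iff)
  then show ?thesis by simp
qed

section \<open>Expansion at the cusp and the maximum principle\<close>

lemma ee_surj:
  assumes "q \<noteq> 0" "norm q < 1"
  obtains \<tau> where "Im \<tau> > 0" "q = ee \<tau>"
proof
  let ?\<tau> = "Ln q / (2 * pi * \<i>)"
  show "q = ee ?\<tau>" using assms by (simp add: ee_def)
  have "Im ?\<tau> = - ln (norm q) / (2 * pi)"
    using assms by (simp add: Im_divide power2_eq_square)
  then show "Im ?\<tau> > 0" using assms by (simp add: divide_neg_pos ln_less_zero)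
qed

context singular_form
begin

text \<open>\<open>m0\<close> is the least element of D/24 + Z that is at least (l,l)/2, so the
  exponents are \<open>m0\<close> + k and r = \<open>m0\<close> - (l,l)/2 is nonnegative. The power
  series converges on the whole disc because every nonzero q there is e(\<tau>) for some \<tau> in
  the upper half-plane.\<close>

lemma theta_coeff_q_expansion:
  assumes l: "l \<in> shadow G"
  shows "\<exists>r p. 0 \<le> r \<and> p holomorphic_on ball 0 1 \<and>
     (\<forall>\<tau>. Im \<tau> > 0 \<longrightarrow> theta_coeff l \<tau> = ee (of_real r * \<tau>) * p (ee \<tau>))"
proof -
  define m0 where "m0 = real_of_int D / 24 + of_int \<lceil>bf G l l / 2 - real_of_int D / 24\<rceil>"
  define r where "r = m0 - bf G l l / 2"
  define p where "p = (\<lambda>q. \<Sum>k. f (m0 + of_nat k) l * q ^ k)"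
  have bij: "bij_betw (\<lambda>k. m0 + of_nat k) (UNIV :: nat set) (exponents l)"
  proof (rule bij_betw_imageI)
    show "inj (\<lambda>k. m0 + of_nat k)" by (auto simp: inj_def)
    show "range (\<lambda>k. m0 + of_nat k) = exponents l"
    proof (intro equalityI subsetI)
      fix m assume "m \<in> range (\<lambda>k. m0 + of_nat k)"
      then obtain k where m: "m = m0 + of_nat k" by blast
      have m_eq: "m - of_int D / 24 = of_int (\<lceil>bf G l l / 2 - real_of_int D / 24\<rceil> + int k)"
        by (simp add: m m0_def)
      have "bf G l l / 2 \<le> m0" unfolding m0_def by linarith
      then have "bf G l l \<le> 2 * m" by (simp add: m)
      moreover have "m - of_int D / 24 \<in> \<int>" unfolding m_eq by (rule Ints_of_int)
      ultimately show "m \<in> exponents l" unfolding exponents_def by simp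
    next
      fix m assume m: "m \<in> exponents l"
      then obtain j where j: "m - of_int D / 24 = of_int j" unfolding exponents_def by (auto elim: Ints_cases)
      have "bf G l l / 2 - of_int D / 24 \<le> of_int j" using m j unfolding exponents_def by simp
      then have "\<lceil>bf G l l / 2 - real_of_int D / 24\<rceil> \<le> j" by (simp add: ceiling_le_iff)
      then have "m = m0 + of_nat (nat (j - \<lceil>bf G l l / 2 - real_of_int D / 24\<rceil>))"
        using j by (simp add: m0_def)
      then show "m \<in> range (\<lambda>k. m0 + of_nat k)" by blast
    qed
  qed
  have sum: "(\<lambda>k. f (m0 + of_nat k) l * ee \<tau> ^ k) sums (ee (- (of_real r * \<tau>)) * theta_coeff l \<tau>)" if \<tau>: "Im \<tau> > 0" for \<tau>
  proof -
    have "((\<lambda>k. f (m0 + of_nat k) l * ee (of_real (m0 + of_nat k - bf G l l / 2) * \<tau>)) has_sum theta_coeff l \<tau>) UNIV"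
      using has_sum_reindex_bij_betw[OF bij, of "\<lambda>m. f m l * ee (of_real (m - bf G l l / 2) * \<tau>)"]
        theta_coeff_has_sum[OF l \<tau>] by blast
    then have "((\<lambda>k. ee (- (of_real r * \<tau>)) * (f (m0 + of_nat k) l * ee (of_real (m0 + of_nat k - bf G l l / 2) * \<tau>))) has_sum
       (ee (- (of_real r * \<tau>)) * theta_coeff l \<tau>)) UNIV"
      by (rule has_sum_cmult_right)
    also have "(\<lambda>k. ee (- (of_real r * \<tau>)) * (f (m0 + of_nat k) l * ee (of_real (m0 + of_nat k - bf G l l / 2) * \<tau>))) =
       (\<lambda>k. f (m0 + of_nat k) l * ee \<tau> ^ k)"
    proof
      fix k :: nat
      have "ee (- (of_real r * \<tau>)) * ee (of_real (m0 + of_nat k - bf G l l / 2) * \<tau>) = ee (of_nat k * \<tau>)"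
        unfolding ee_add[symmetric] by (simp add: r_def algebra_simps)
      also have "\<dots> = ee \<tau> ^ k" by (simp add: ee_def exp_of_nat_mult[symmetric] mult_ac)
      finally show "ee (- (of_real r * \<tau>)) * (f (m0 + of_nat k) l * ee (of_real (m0 + of_nat k - bf G l l / 2) * \<tau>)) =
        f (m0 + of_nat k) l * ee \<tau> ^ k" by (simp add: mult_ac)
    qed
    finally show ?thesis by (rule has_sum_imp_sums)
  qed
  have "p holomorphic_on ball 0 1"
  proof (rule power_series_holomorphic)
    fix q :: complex assume q: "q \<in> ball 0 1"
    have "summable (\<lambda>k. f (m0 + of_nat k) l * q ^ k)"
    proof (cases "q = 0")
      case False
      then obtain \<tau> where "Im \<tau> > 0" "q = ee \<tau>" using q ee_surj[of q] by auto
      then show ?thesis using sum sums_summable by blast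
    qed (simp add: summable_0_powser del: power_0_left)
    then show "(\<lambda>k. f (m0 + of_nat k) l * (q - 0) ^ k) sums p q"
      by (simp add: p_def summable_sums)
  qed
  moreover have "theta_coeff l \<tau> = ee (of_real r * \<tau>) * p (ee \<tau>)" if "Im \<tau> > 0" for \<tau>
  proof -
    have "p (ee \<tau>) = ee (- (of_real r * \<tau>)) * theta_coeff l \<tau>"
      using sums_unique[OF sum[OF that]] by (simp add: p_def)
    then show ?thesis by (simp add: ee_minus)
  qed
  moreover have "0 \<le> r" unfolding r_def m0_def by linarith
  ultimately show ?thesis by blast
qed

text \<open>\<open>mass\<close> is a continuous function of \<open>q = ee \<tau>\<close>, including \<open>q = 0\<close>. Translating to
  \<open>|Re \<tau>| \<le> 1/2\<close> and inverting at least doubles an imaginary part below \<open>1/2\<close>, so its supremum is attained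
  on the compact disc \<open>|q| \<le> exp (-\<pi>)\<close>. A maximum at the cusp \<open>q = 0\<close> only sees the coefficients whose
  leading exponent \<open>r\<close> vanishes; the others are then identically 0.\<close>

lemma theta_coeff_constant:
  assumes l: "l \<in> shadow G" and \<tau>: "Im \<tau> > 0" "Im \<tau>' > 0"
  shows "theta_coeff l \<tau> = theta_coeff l \<tau>'"
proof -
  define R where "R = shadow G \<inter> unit_cube"
  have R: "finite R" unfolding R_def by (rule finite_shadow_cube)
  obtain r p where r: "\<And>\<mu>. \<mu> \<in> R \<Longrightarrow> 0 \<le> r \<mu>" and p: "\<And>\<mu>. \<mu> \<in> R \<Longrightarrow> p \<mu> holomorphic_on ball 0 1"
    and theta: "\<And>\<mu> \<tau>. \<mu> \<in> R \<Longrightarrow> Im \<tau> > 0 \<Longrightarrow> theta_coeff \<mu> \<tau> = ee (of_real (r \<mu>) * \<tau>) * p \<mu> (ee \<tau>)"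
    using theta_coeff_q_expansion unfolding R_def by (metis IntD1)
  \<comment> \<open>The weight |q|^(2r). The case r = 0 is separated because \<open>0 powr 0\<close>
    is 0 in HOL, whereas the weight has to be 1 at the cusp for \<open>E\<close> to be continuous
    there.\<close>
  define w where "w = (\<lambda>\<mu> q. if r \<mu> = 0 then 1 else norm (q::complex) powr (2 * r \<mu>))"
  define E where "E = (\<lambda>q. \<Sum>\<mu>\<in>R. w \<mu> q * (norm (p \<mu> q))\<^sup>2)"
  have mass_E: "mass \<tau> = E (ee \<tau>)" if "Im \<tau> > 0" for \<tau>
  proof -
    have "(norm (ee (of_real (r \<mu>) * \<tau>)))\<^sup>2 = w \<mu> (ee \<tau>)" for \<mu>
      by (simp add: w_def norm_ee exp_double[symmetric] powr_def)
    then show ?thesis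
      unfolding mass_def E_def R_def[symmetric] using theta[OF _ that]
      by (intro sum.cong refl) (simp add: norm_mult power_mult_distrib)
  qed
  have exp_pi: "exp (- pi) < 1" by simp
  have cont: "continuous_on (cball 0 (exp (- pi))) E"
  proof -
    have "continuous_on (cball 0 (exp (- pi))) (w \<mu>)" if "\<mu> \<in> R" for \<mu>
    proof (cases "r \<mu> = 0")
      case False
      have "continuous_on (cball 0 (exp (- pi))) (\<lambda>q::complex. norm q powr (2 * r \<mu>))"
        by (rule continuous_on_powr') (use r[OF that] False in \<open>auto intro!: continuous_intros\<close>)
      then show ?thesis unfolding w_def using False by simp
    qed (simp add: w_def)
    moreover have "continuous_on (cball 0 (exp (- pi))) (p \<mu>)" if "\<mu> \<in> R" for \<mu>
      by (rule continuous_on_subset[OF holomorphic_on_imp_continuous_on[OF p[OF that]]]) (auto intro: order.strict_trans1[OF _ exp_pi])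
    ultimately show ?thesis unfolding E_def by (intro continuous_intros)
  qed
  obtain q0 where q0: "q0 \<in> cball 0 (exp (- pi))" and q0_max: "\<And>q. q \<in> cball 0 (exp (- pi)) \<Longrightarrow> E q \<le> E q0"
    using continuous_attains_sup[OF compact_cball _ cont] by fastforce
  \<comment> \<open>\<open>N\<close> counts doublings: below 1/2, a translation and an inversion
    raise an imaginary part of at least 1/2/2^(N+1) to at least 1/2/2^N, and from 1/2 on |e(\<tau>)|
    \<le> exp(-\<pi>).\<close>
  have mass_le_aux: "Im \<tau> \<ge> 1 / 2 / 2 ^ N \<Longrightarrow> mass \<tau> \<le> E q0" for N \<tau>
  proof (induction N arbitrary: \<tau>)
    case 0
    then show ?case using mass_E[of \<tau>] q0_max[of "ee \<tau>"] by (simp add: norm_ee)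
  next
    case (Suc N)
    have "(0::real) < 1 / 2 / 2 ^ Suc N" by simp
    with Suc.prems have \<tau>: "Im \<tau> > 0" by linarith
    show ?case
    proof (cases "Im \<tau> \<ge> 1 / 2")
      case True
      then show ?thesis using mass_E[of \<tau>] q0_max[of "ee \<tau>"] by (simp add: norm_ee)
    next
      case False
      \<comment> \<open>|Re \<sigma>| \<le> 1/2 and Im \<sigma> < 1/2 give |\<sigma>|^2 \<le> 1/2,
        whence the factor 2 in Im(-1/\<sigma>) = Im \<sigma>/|\<sigma>|^2.\<close>
      define \<sigma> where "\<sigma> = \<tau> - of_int (round (Re \<tau>))"
      have Im_\<sigma>: "Im \<sigma> = Im \<tau>" by (simp add: \<sigma>_def)
      have "\<bar>Re \<sigma>\<bar> \<le> 1 / 2" using of_int_round_abs_le[of "Re \<tau>"] by (simp add: \<sigma>_def abs_minus_commute)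
      then have "(Re \<sigma>)\<^sup>2 \<le> (1 / 2)\<^sup>2" by (simp only: abs_le_square_iff[symmetric])
      moreover have "(Im \<sigma>)\<^sup>2 \<le> (1 / 2)\<^sup>2" using False \<tau> by (intro power_mono) (auto simp: Im_\<sigma>)
      ultimately have n: "(norm \<sigma>)\<^sup>2 \<le> 1 / 2" unfolding cmod_power2 by (simp add: power2_eq_square)
      have "(norm \<sigma>)\<^sup>2 > 0" using \<tau> Im_\<sigma> by auto
      then have "2 * Im \<tau> \<le> Im (- 1 / \<sigma>)"
        unfolding Im_minus_inverse Im_\<sigma> using n \<tau> by (simp add: le_divide_eq)
      then have "mass (- 1 / \<sigma>) \<le> E q0"
        using Suc.prems by (intro Suc.IH) simp
      also have "mass (- 1 / \<sigma>) = mass \<sigma>" using \<tau> Im_\<sigma> by (intro mass_inversion) simp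
      also have "\<dots> = mass \<tau>"
      proof -
        have "ee \<sigma> = ee \<tau>" using ee_int[of "of_int (round (Re \<tau>))"] by (simp add: \<sigma>_def ee_diff)
        then show ?thesis using mass_E \<tau> Im_\<sigma> by simp
      qed
      finally show ?thesis .
    qed
  qed
  have mass_le: "mass \<tau> \<le> E q0" if "Im \<tau> > 0" for \<tau>
  proof -
    obtain N where "1 / (2 * Im \<tau>) < 2 ^ N" using real_arch_pow[of 2] by auto
    then have "1 / 2 / 2 ^ N \<le> Im \<tau>" using that by (simp add: field_simps)
    then show ?thesis by (rule mass_le_aux)
  qed
  have E_le: "E q \<le> E q0" if q: "q \<in> ball 0 1" for q
  proof (cases "q = 0")
    case True then show ?thesis by (intro q0_max) simp
  next
    case False
    then obtain \<tau> where "Im \<tau> > 0" "q = ee \<tau>" using q ee_surj[of q] by auto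
    then show ?thesis using mass_le mass_E by metis
  qed
  have q0_ball: "q0 \<in> ball 0 1" using q0 by (auto intro: order.strict_trans1[OF _ exp_pi])
  have ee_ball: "ee \<tau> \<in> ball 0 1" if "Im \<tau> > 0" for \<tau> using that by (simp add: norm_ee)
  have const: "theta_coeff \<mu> \<tau> = theta_coeff \<mu> \<tau>'" if \<mu>: "\<mu> \<in> R" for \<mu>
  proof (cases "q0 = 0")
    case False
    then obtain \<tau>0 where \<tau>0: "Im \<tau>0 > 0" "q0 = ee \<tau>0" using q0_ball ee_surj[of q0] by auto
    have "theta_coeff \<mu> t = theta_coeff \<mu> \<tau>0" if t: "Im t > 0" for t
    proof (rule holomorphic_vector_maximum_constant[where S="{t. Im t > 0}" and R=R and h=theta_coeff])
      show "open {t. Im t > 0}" by (simp add: open_halfspace_Im_gt)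
      show "connected {t. Im t > 0}" by (intro convex_connected convex_halfspace_Im_gt)
      show "theta_coeff \<nu> holomorphic_on {t. Im t > 0}" if \<nu>: "\<nu> \<in> R" for \<nu>
      proof (rule holomorphic_transform)
        show "(\<lambda>t. ee (of_real (r \<nu>) * t) * p \<nu> (ee t)) holomorphic_on {t. Im t > 0}"
          by (intro holomorphic_intros holomorphic_on_compose_gen[OF _ p[OF \<nu>], unfolded o_def])
             (auto intro: ee_ball)
      qed (simp add: theta \<nu>)
      show "(\<Sum>k\<in>R. (norm (theta_coeff k z))\<^sup>2) \<le> (\<Sum>k\<in>R. (norm (theta_coeff k \<tau>0))\<^sup>2)" if "z \<in> {t. Im t > 0}" for z
        using mass_le[of z] that mass_E[of \<tau>0] \<tau>0 by (simp add: mass_def R_def)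
    qed (use \<tau>0 t R \<mu> in auto)
    then show ?thesis using \<tau> by simp
  next
    case True
    define R0 where "R0 = {\<mu>\<in>R. r \<mu> = 0}"
    have R0: "finite R0" "R0 \<subseteq> R" using R by (auto simp: R0_def)
    have E_split: "E q = (\<Sum>\<mu>\<in>R0. (norm (p \<mu> q))\<^sup>2) + (\<Sum>\<mu>\<in>R-R0. w \<mu> q * (norm (p \<mu> q))\<^sup>2)" for q
    proof -
      have "E q = (\<Sum>\<mu>\<in>R0. w \<mu> q * (norm (p \<mu> q))\<^sup>2) + (\<Sum>\<mu>\<in>R-R0. w \<mu> q * (norm (p \<mu> q))\<^sup>2)"
        unfolding E_def by (subst sum.subset_diff[OF R0(2) R]) (rule add.commute)
      also have "(\<Sum>\<mu>\<in>R0. w \<mu> q * (norm (p \<mu> q))\<^sup>2) = (\<Sum>\<mu>\<in>R0. (norm (p \<mu> q))\<^sup>2)"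
        by (rule sum.cong) (auto simp: R0_def w_def)
      finally show ?thesis .
    qed
    have rest_nonneg: "0 \<le> (\<Sum>\<mu>\<in>R-R0. w \<mu> q * (norm (p \<mu> q))\<^sup>2)" for q
      by (intro sum_nonneg mult_nonneg_nonneg) (auto simp: w_def)
    have E0: "E q0 = (\<Sum>\<mu>\<in>R0. (norm (p \<mu> q0))\<^sup>2)"
      unfolding E_split by (simp add: True w_def R0_def)
    have p_const: "p \<nu> q = p \<nu> q0" if q: "q \<in> ball 0 1" and \<nu>: "\<nu> \<in> R0" for q \<nu>
    proof (rule holomorphic_vector_maximum_constant[where S="ball 0 1" and R=R0 and h=p])
      show "(\<Sum>k\<in>R0. (norm (p k z))\<^sup>2) \<le> (\<Sum>k\<in>R0. (norm (p k q0))\<^sup>2)" if "z \<in> ball 0 1" for z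
        using E_le[OF that] rest_nonneg[of z] unfolding E0 E_split[of z] by linarith
    qed (use q \<nu> q0_ball R0 p in auto)
    show ?thesis
    proof (cases "r \<mu> = 0")
      case True
      then have "\<mu> \<in> R0" using \<mu> by (simp add: R0_def)
      then have "p \<mu> (ee \<tau>) = p \<mu> (ee \<tau>')" using p_const ee_ball \<tau> by metis
      then show ?thesis using theta \<mu> \<tau> True by simp
    next
      case False
      \<comment> \<open>The part of \<open>E\<close> over \<open>R0\<close> is constant and already
        equals the maximum of \<open>E\<close>, so the nonnegative remainder must vanish.\<close>
      have zero: "theta_coeff \<mu> t = 0" if t: "Im t > 0" for t
      proof -
        have "E (ee t) = E q0 + (\<Sum>\<mu>\<in>R-R0. w \<mu> (ee t) * (norm (p \<mu> (ee t)))\<^sup>2)"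
          unfolding E_split[of "ee t"] E0 using p_const[OF ee_ball[OF t]] by simp
        then have "(\<Sum>\<mu>\<in>R-R0. w \<mu> (ee t) * (norm (p \<mu> (ee t)))\<^sup>2) = 0"
          using E_le[OF ee_ball[OF t]] rest_nonneg[of "ee t"] by linarith
        then have "w \<mu> (ee t) * (norm (p \<mu> (ee t)))\<^sup>2 = 0"
          using R \<mu> False by (subst (asm) sum_nonneg_eq_0_iff) (auto simp: w_def R0_def)
        then have "p \<mu> (ee t) = 0" using False by (simp add: w_def)
        then show ?thesis using theta \<mu> t by simp
      qed
      then show ?thesis using \<tau> by simp
    qed
  qed
  obtain \<mu> q where "\<mu> \<in> R" "l = \<mu> + ivec q"
    using shadow_bij l unfolding bij_betw_def R_def by fastforce
  then show ?thesis
    using const[of \<mu>] theta_coeff_shift[of \<mu> _ q] \<tau> by (simp add: R_def)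
qed

corollary constant_theta_expansion:
  "\<exists>c. \<forall>\<tau> z. Im \<tau> > 0 \<longrightarrow>
     ((\<lambda>l. c l * ee (of_real (bf G l l / 2) * \<tau> + bf G (rvec l) z)) has_sum \<phi> \<tau> z) (shadow G)"
proof (intro exI allI impI)
  fix \<tau> z assume \<tau>: "Im \<tau> > 0"
  have "theta_coeff l \<i> = theta_coeff l \<tau>" if "l \<in> shadow G" for l
    by (rule theta_coeff_constant[OF that _ \<tau>]) simp
  then have "((\<lambda>l. theta_coeff l \<i> * ee (of_real (bf G l l / 2) * \<tau> + bf G (rvec l) z)) has_sum \<phi> \<tau> z) (shadow G) \<longleftrightarrow>
     ((\<lambda>l. theta_coeff l \<tau> * ee (of_real (bf G l l / 2) * \<tau> + bf G (rvec l) z)) has_sum \<phi> \<tau> z) (shadow G)"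
    by (intro has_sum_cong) simp
  then show "((\<lambda>l. theta_coeff l \<i> * ee (of_real (bf G l l / 2) * \<tau> + bf G (rvec l) z)) has_sum \<phi> \<tau> z) (shadow G)"
    using theta_expansion[OF \<tau>] by blast
qed

end

section \<open>Reflection and multiplicity\<close>

lemma holomorphic_on_infsum:
  fixes t :: "'k \<Rightarrow> complex \<Rightarrow> complex"
  assumes S: "open S" and hol: "\<And>k. k \<in> K \<Longrightarrow> t k holomorphic_on S"
    and dom: "\<And>w. w \<in> S \<Longrightarrow> \<exists>d>0. cball w d \<subseteq> S \<and> (\<exists>M. M summable_on K \<and> (\<forall>k\<in>K. \<forall>u\<in>cball w d. norm (t k u) \<le> M k))"
  shows "(\<lambda>w. \<Sum>\<^sub>\<infinity>k\<in>K. t k w) holomorphic_on S"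
proof -
  have "\<exists>F'. ((\<lambda>w. \<Sum>\<^sub>\<infinity>k\<in>K. t k w) has_field_derivative F') (at w)" if w: "w \<in> S" for w
  proof -
    obtain d M where d: "d > 0" "cball w d \<subseteq> S" and M: "M summable_on K" "\<And>k u. k \<in> K \<Longrightarrow> u \<in> cball w d \<Longrightarrow> norm (t k u) \<le> M k"
      using dom[OF w] by blast
    have lim: "uniform_limit (cball w d) (\<lambda>X u. \<Sum>k\<in>X. t k u) (\<lambda>u. \<Sum>\<^sub>\<infinity>k\<in>K. t k u) (finite_subsets_at_top K)"
      by (rule Weierstrass_m_test_general[OF M(2,1)])
    have ev: "eventually (\<lambda>X. continuous_on (cball w d) (\<lambda>u. \<Sum>k\<in>X. t k u) \<and> (\<lambda>u. \<Sum>k\<in>X. t k u) holomorphic_on ball w d) (finite_subsets_at_top K)"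
    proof (rule eventually_finite_subsets_at_top_weakI)
      fix X assume "finite X" "X \<subseteq> K"
      then have h: "(\<lambda>u. \<Sum>k\<in>X. t k u) holomorphic_on cball w d"
        using d(2) by (intro holomorphic_intros holomorphic_on_subset[OF hol]) auto
      then show "continuous_on (cball w d) (\<lambda>u. \<Sum>k\<in>X. t k u) \<and> (\<lambda>u. \<Sum>k\<in>X. t k u) holomorphic_on ball w d"
        using holomorphic_on_imp_continuous_on holomorphic_on_subset[OF h ball_subset_cball] by blast
    qed
    have "(\<lambda>u. \<Sum>\<^sub>\<infinity>k\<in>K. t k u) holomorphic_on ball w d"
      by (rule holomorphic_uniform_limit[OF ev lim]) auto
    then show ?thesis using d(1) by (auto simp: holomorphic_on_open)
  qed
  then show ?thesis using S by (simp add: holomorphic_on_open)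
qed

text \<open>The entire function i sin(2 \<pi> b w)/w, with the removable singularity at 0 filled in.
  It is what remains of the pair l, \<sigma>_v(l) after division by w = (v,z), where b is the
  v-component of l.\<close>

definition sinq :: "real \<Rightarrow> complex \<Rightarrow> complex" where
  "sinq b w = (if w = 0 then 2 * pi * \<i> * of_real b else (ee (of_real b * w) - ee (- (of_real b * w))) / (2 * w))"

lemma sinq_mult: "w * sinq b w = (ee (of_real b * w) - ee (- (of_real b * w))) / 2"
  by (simp add: sinq_def)

lemma sinq_holomorphic: "sinq b holomorphic_on UNIV"
proof -
  let ?f = "\<lambda>w. (ee (of_real b * w) - ee (- (of_real b * w))) / 2"
  have "(?f has_field_derivative 2 * pi * \<i> * of_real b) (at 0)"
    unfolding ee_def by (auto intro!: derivative_eq_intros)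
  then have "deriv ?f 0 = 2 * pi * \<i> * of_real b" by (rule DERIV_imp_deriv)
  then have eq: "sinq b = (\<lambda>z. if z = 0 then deriv ?f 0 else (?f z - ?f 0) / (z - 0))"
    by (auto simp: sinq_def fun_eq_iff)
  show ?thesis
    unfolding eq by (rule pole_lemma_open) (auto intro!: holomorphic_intros)
qed

text \<open>The mean value inequality gives 2 \<pi> |b| exp(2 \<pi> |b| T); the linear factor costs
  one more exp(2 \<pi> |b|), whence 1 + T. Replacing |b| by the sum over both signs yields
  exponentials of linear functions of b, which can be absorbed into theta terms.\<close>

lemma sinq_bound:
  assumes "norm w \<le> T"
  shows "norm (sinq b w) \<le> exp (2 * pi * (b * (1 + T))) + exp (- (2 * pi * (b * (1 + T))))"
proof -
  have T: "T \<ge> 0" using assms by (rule order_trans[OF norm_ge_zero])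
  have le: "2 * pi * \<bar>b\<bar> \<le> exp (2 * pi * \<bar>b\<bar>)" using exp_ge_add_one_self[of "2 * pi * \<bar>b\<bar>"] by linarith
  have "norm (sinq b w) \<le> 2 * pi * \<bar>b\<bar> * exp (2 * pi * \<bar>b\<bar> * T)"
  proof (cases "w = 0")
    case True
    then show ?thesis using T mult_left_mono[of 1 "exp (2 * pi * \<bar>b\<bar> * T)" "2 * pi * \<bar>b\<bar>"]
      by (simp add: sinq_def norm_mult)
  next
    case False
    define u where "u = 2 * pi * \<i> * (of_real b * w)"
    have nu: "norm u = 2 * pi * \<bar>b\<bar> * norm w" by (simp add: u_def norm_mult)
    have "norm (exp u - exp (- u)) \<le> exp (norm u) * norm (u - (- u))"
    proof (rule field_differentiable_bound[where S="cball 0 (norm u)" and f'=exp])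
      show "norm (exp z) \<le> exp (norm u)" if "z \<in> cball 0 (norm u)" for z
        using that by (auto intro: order_trans[OF norm_exp])
    qed (auto intro!: derivative_eq_intros)
    also have "norm (u - (- u)) = 2 * norm u" by (simp add: norm_mult flip: mult_2)
    finally have "norm (exp u - exp (- u)) / (2 * norm w) \<le> exp (norm u) * (2 * norm u) / (2 * norm w)"
      by (rule divide_right_mono) simp
    moreover have "norm (sinq b w) = norm (exp u - exp (- u)) / (2 * norm w)"
      using False by (simp add: sinq_def ee_def u_def norm_divide norm_mult)
    ultimately have "norm (sinq b w) \<le> exp (norm u) * (2 * norm u) / (2 * norm w)" by simp
    also have "\<dots> = 2 * pi * \<bar>b\<bar> * exp (norm u)" using False by (simp add: nu)
    also have "exp (norm u) \<le> exp (2 * pi * \<bar>b\<bar> * T)"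
      unfolding nu using assms by (simp add: mult_left_mono)
    finally show ?thesis by (simp add: mult_left_mono)
  qed
  also have "\<dots> \<le> exp (2 * pi * \<bar>b\<bar>) * exp (2 * pi * \<bar>b\<bar> * T)"
    using le by (intro mult_right_mono) auto
  also have "\<dots> = exp (2 * pi * (\<bar>b\<bar> * (1 + T)))" by (simp add: exp_add[symmetric] algebra_simps)
  also have "\<dots> \<le> exp (2 * pi * (b * (1 + T))) + exp (- (2 * pi * (b * (1 + T))))"
    by (cases "b \<ge> 0") auto
  finally show ?thesis .
qed

text \<open>\<open>C\<close> lives on all real vectors, in the application as an extension by 0 from
  the shadow: \<sigma>_v may fail to preserve the shadow, and the extension lets it act on the index
  set. Where \<sigma>_v(l) leaves the shadow, antisymmetry says that the coefficient of l
  vanishes.\<close>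

locale theta_series = lattice_form G for G :: "int^'n^'n" +
  fixes C :: "real^'n \<Rightarrow> complex" and \<phi> :: "complex \<Rightarrow> complex^'n \<Rightarrow> complex" and v :: "real^'n"
  assumes expansion: "Im \<tau> > 0 \<Longrightarrow>
      ((\<lambda>l. C l * ee (of_real (bf G l l / 2) * \<tau> + bf G (rvec l) z)) has_sum \<phi> \<tau> z) UNIV"
    and v_nonzero: "v \<noteq> 0"
    and vanishing: "Im \<tau> > 0 \<Longrightarrow> bf G (rvec v) z = 0 \<Longrightarrow> \<phi> \<tau> z = 0"
    and nonzero: "\<exists>\<tau> z. Im \<tau> > 0 \<and> \<phi> \<tau> z \<noteq> 0"
begin

section \<open>Orthogonal decomposition along v\<close>

definition vcomp :: "real^'n \<Rightarrow> real" where "vcomp l = bf G l v / bf G v v"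
definition vproj :: "real^'n \<Rightarrow> real^'n" where "vproj l = l - vcomp l *\<^sub>R v"
definition vrefl :: "real^'n \<Rightarrow> real^'n" where "vrefl l = l - (2 * vcomp l) *\<^sub>R v"

lemma vv_pos: "bf G v v > 0"
  using bf_pos[OF v_nonzero] .

lemma vcomp_vrefl [simp]: "vcomp (vrefl l) = - vcomp l"
  using vv_pos by (simp add: vcomp_def vrefl_def bf_linear field_simps)

lemma vrefl_vrefl [simp]: "vrefl (vrefl l) = l"
  unfolding vrefl_def[of "vrefl l"] vcomp_vrefl by (simp add: vrefl_def)

lemma vproj_vrefl [simp]: "vproj (vrefl l) = vproj l"
  unfolding vproj_def vcomp_vrefl by (simp add: vrefl_def vec_eq_iff algebra_simps)

lemma vrefl_eq: "vrefl l = vproj l - vcomp l *\<^sub>R v"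
  by (simp add: vproj_def vrefl_def vec_eq_iff algebra_simps)

lemma vproj_orth [simp]: "bf G v (vproj l) = 0" "bf G (vproj l) v = 0"
  using vv_pos bf_sym[of v l] by (simp_all add: vproj_def bf_linear vcomp_def)

lemma decompose: "l = vproj l + vcomp l *\<^sub>R v"
  by (simp add: vproj_def)

lemma bf_vproj_swap: "bf G l (vproj y) = bf G (vproj l) y"
  using bf_sym[of v y] by (simp add: vproj_def bf_linear vcomp_def)

lemma bf_decompose: "bf G l l = bf G (vproj l) (vproj l) + (vcomp l)\<^sup>2 * bf G v v"
  by (subst (1 2) decompose[of l]) (simp add: bf_linear power2_eq_square)

lemma bf_vrefl [simp]: "bf G (vrefl l) (vrefl l) = bf G l l"
  by (simp add: bf_decompose[of "vrefl l"] bf_decompose[of l])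

lemma bij_vrefl: "bij vrefl"
  by (rule involuntory_imp_bij) simp

text \<open>Along (a, y) the index l has frequency \<pi>(l,l) in a and 2\<pi>
  \<open>gvec G (vproj l)\<close> in y. Norm and projection determine the v-component up to sign, so
  a fibre is {l, \<sigma>_v(l)}, a single point when that component is 0. The coefficients are
  arbitrary because the lemma serves both \<phi> and the quotient.\<close>

lemma coefficient_pairing:
  assumes zero: "\<And>a y. ((\<lambda>l. b l * ee (of_real (bf G l l / 2) * (\<i> + of_real a) + of_real (bf G (vproj l) y))) has_sum 0) UNIV"
  shows "vcomp l = 0 \<Longrightarrow> b l = 0" "vcomp l \<noteq> 0 \<Longrightarrow> b l + b (vrefl l) = 0"
proof -
  define A where "A = (\<lambda>l. b l * ee (of_real (bf G l l / 2) * \<i>))"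
  define \<omega> where "\<omega> = (\<lambda>l. (pi * bf G l l, (2 * pi) *\<^sub>R gvec G (vproj l)))"
  have "(A has_sum 0) {k\<in>UNIV. \<omega> k = \<omega> l}"
  proof (rule has_sum_exponentials_frequency)
    show "A summable_on UNIV"
      using has_sum_imp_summable[OF zero[of 0 0]] by (simp add: A_def)
    fix s :: "real \<times> (real^'n)"
    show "((\<lambda>k. A k * exp (\<i> * complex_of_real (\<omega> k \<bullet> s))) has_sum 0) UNIV"
    proof (rule has_sum_cong[THEN iffD1, OF _ zero[of "fst s" "snd s"]])
      fix k
      have "exp (\<i> * complex_of_real (\<omega> k \<bullet> s)) = ee (of_real (bf G k k / 2) * of_real (fst s) + of_real (bf G (vproj k) (snd s)))"
        by (simp add: \<omega>_def inner_prod_def ee_def bf_gvec algebra_simps)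
      then show "b k * ee (of_real (bf G k k / 2) * (\<i> + of_real (fst s)) + of_real (bf G (vproj k) (snd s))) = A k * exp (\<i> * complex_of_real (\<omega> k \<bullet> s))"
        by (simp only: A_def distrib_left ee_add mult.assoc)
    qed
  qed
  moreover have "{k\<in>UNIV. \<omega> k = \<omega> l} = {l, vrefl l}"
  proof (intro equalityI subsetI)
    fix k assume "k \<in> {k\<in>UNIV. \<omega> k = \<omega> l}"
    then have "vproj k = vproj l" "bf G k k = bf G l l" by (simp_all add: \<omega>_def gvec_inj)
    then have "(vcomp k)\<^sup>2 = (vcomp l)\<^sup>2"
      using bf_decompose[of k] bf_decompose[of l] vv_pos by simp
    then have "vcomp k = vcomp l \<or> vcomp k = - vcomp l" by (simp add: power2_eq_iff)
    then show "k \<in> {l, vrefl l}"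
      using decompose[of k] decompose[of l] vrefl_eq[of l] \<open>vproj k = vproj l\<close> by auto
  qed (auto simp: \<omega>_def)
  ultimately have sum: "sum A {l, vrefl l} = 0" by (simp add: has_sum_finite_iff)
  show "b l = 0" if "vcomp l = 0"
    using sum that by (simp add: A_def vrefl_def)
  show "b l + b (vrefl l) = 0" if "vcomp l \<noteq> 0"
  proof -
    have "vrefl l \<noteq> l" using that v_nonzero by (simp add: vrefl_def)
    then have "(b l + b (vrefl l)) * ee (of_real (bf G l l / 2) * \<i>) = 0"
      using sum by (simp add: A_def distrib_right)
    then show ?thesis by simp
  qed
qed

lemma bf_rvec_vproj [simp]: "bf G (rvec v) (rvec (vproj y)) = 0"
  by (simp add: bf_rvec)

lemma C_vrefl: "C (vrefl l) = - C l" and C_orth: "vcomp l = 0 \<Longrightarrow> C l = 0"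
proof -
  have *: "((\<lambda>l. C l * ee (of_real (bf G l l / 2) * (\<i> + of_real a) + of_real (bf G (vproj l) y))) has_sum 0) UNIV" for a y
  proof -
    have "\<phi> (\<i> + of_real a) (rvec (vproj y)) = 0" by (rule vanishing) auto
    then show ?thesis using expansion[of "\<i> + of_real a" "rvec (vproj y)"]
      by (simp add: bf_rvec bf_vproj_swap)
  qed
  show "C l = 0" if "vcomp l = 0" using coefficient_pairing(1)[OF * that] .
  show "C (vrefl l) = - C l"
  proof (cases "vcomp l = 0")
    case True
    then show ?thesis using coefficient_pairing(1)[OF *] by (simp add: vrefl_def)
  next
    case False
    then show ?thesis using coefficient_pairing(2)[OF * False] by (simp add: add_eq_0_iff)
  qed
qed

lemma has_sum_vrefl:
  assumes \<tau>: "Im \<tau> > 0"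
  shows "((\<lambda>l. C l * ee (of_real (bf G l l / 2) * \<tau> + bf G (rvec (vrefl l)) z)) has_sum (- \<phi> \<tau> z)) UNIV"
proof -
  have "((\<lambda>l. - (C l * ee (of_real (bf G l l / 2) * \<tau> + bf G (rvec l) z))) has_sum (- \<phi> \<tau> z)) UNIV"
    by (intro has_sum_uminusI expansion \<tau>)
  then have "((\<lambda>l. - (C (vrefl l) * ee (of_real (bf G (vrefl l) (vrefl l) / 2) * \<tau> + bf G (rvec (vrefl l)) z))) has_sum (- \<phi> \<tau> z)) UNIV"
    using has_sum_reindex_bij_betw[OF bij_vrefl, of "\<lambda>l. - (C l * ee (of_real (bf G l l / 2) * \<tau> + bf G (rvec l) z))"] by blast
  then show ?thesis by (simp add: C_vrefl)
qed

text \<open>The reflection is self-adjoint for the form, so it moves from z to the index l, where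
  \<open>has_sum_vrefl\<close> applies.\<close>

lemma reflection_antisymmetric:
  assumes \<tau>: "Im \<tau> > 0"
  shows "\<phi> \<tau> (reflection G v z) = - \<phi> \<tau> z"
proof -
  have "bf G (rvec l) (reflection G v z) = bf G (rvec (vrefl l)) z" for l
  proof -
    have "reflection G v z = z - (2 * bf G (rvec v) z / bf G (rvec v) (rvec v)) *s rvec v"
      by (simp add: reflection_def vec_eq_iff)
    then show ?thesis
      by (simp add: bf_linear vrefl_def rvec_diff rvec_scaleR bf_rvec vcomp_def)
  qed
  then have "((\<lambda>l. C l * ee (of_real (bf G l l / 2) * \<tau> + bf G (rvec (vrefl l)) z)) has_sum \<phi> \<tau> (reflection G v z)) UNIV"
    using expansion[OF \<tau>, of "reflection G v z"] by simp
  then show ?thesis using has_sum_vrefl[OF \<tau>, of z] has_sum_unique by blast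
qed

text \<open>The terms of l and \<sigma>_v(l) share the factor coming from \<open>vproj l\<close> and
  have opposite coefficients; this is half their sum divided by (v,z), continued to the
  hyperplane.\<close>

definition quot_term :: "real^'n \<Rightarrow> complex \<Rightarrow> complex^'n \<Rightarrow> complex" where
  "quot_term l \<tau> z = C l * ee (of_real (bf G l l / 2) * \<tau> + bf G (rvec (vproj l)) z) * sinq (vcomp l) (bf G (rvec v) z)"

definition quot :: "complex \<Rightarrow> complex^'n \<Rightarrow> complex" where
  "quot \<tau> z = (\<Sum>\<^sub>\<infinity>l. quot_term l \<tau> z)"

text \<open>The absolute value of the theta term at \<open>\<tau> = \<i> h\<close>, \<open>z = \<i> u\<close>.\<close>

definition majorant :: "real \<Rightarrow> real^'n \<Rightarrow> real^'n \<Rightarrow> real" where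
  "majorant h u l = norm (C l) * exp (- (2 * pi * (bf G l l / 2 * h + bf G l u)))"

text \<open>The expansion of \<phi> converges absolutely at every point, so its own terms at purely
  imaginary arguments supply the dominating series for \<open>quot\<close>.\<close>

lemma majorant_summable: "h > 0 \<Longrightarrow> majorant h u summable_on UNIV"
proof -
  assume h: "h > 0"
  have "(\<lambda>l. norm (C l * ee (of_real (bf G l l / 2) * (\<i> * of_real h) + bf G (rvec l) (\<i> *s rvec u)))) summable_on UNIV"
    using has_sum_imp_summable[OF expansion[of "\<i> * of_real h" "\<i> *s rvec u"]] h
    by (subst summable_on_iff_abs_summable_on_complex[symmetric]) simp
  then show ?thesis
    by (simp add: majorant_def[abs_def] norm_mult norm_ee bf_linear bf_rvec)
qed

text \<open>The exponents in \<open>sinq_bound\<close> are multiples of (l,v)/(v,v), hence of the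
  form (l,u) with u a multiple of v: they only move the point at which the majorant is taken. The
  other factor depends on Im z through its projection alone.\<close>

lemma quot_term_bound:
  assumes \<tau>: "Im \<tau> \<ge> h" and T: "norm (bf G (rvec v) z) \<le> T"
  shows "norm (quot_term l \<tau> z) \<le>
     majorant h (vproj (\<chi> i. Im (z$i)) + ((1 + T) / bf G v v) *\<^sub>R v) l +
     majorant h (vproj (\<chi> i. Im (z$i)) - ((1 + T) / bf G v v) *\<^sub>R v) l"
proof -
  define y where "y = (\<chi> i. Im (z$i))"
  define N where "N = bf G l l / 2 * h + bf G (vproj l) y"
  have "norm (quot_term l \<tau> z) = norm (C l) * exp (- 2 * pi * (bf G l l / 2 * Im \<tau> + bf G (vproj l) y)) * norm (sinq (vcomp l) (bf G (rvec v) z))"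
    by (simp add: quot_term_def norm_mult norm_ee Im_bf_rvec y_def)
  also have "\<dots> \<le> norm (C l) * exp (- 2 * pi * N) * (exp (2 * pi * (vcomp l * (1 + T))) + exp (- (2 * pi * (vcomp l * (1 + T)))))"
  proof (intro mult_mono mult_nonneg_nonneg sinq_bound T)
    have "bf G l l / 2 * h \<le> bf G l l / 2 * Im \<tau>"
      using bf_nonneg[of l] \<tau> by (intro mult_left_mono) auto
    then show "exp (- 2 * pi * (bf G l l / 2 * Im \<tau> + bf G (vproj l) y)) \<le> exp (- 2 * pi * N)"
      by (simp add: N_def)
  qed auto
  also have "\<dots> = norm (C l) * exp (- (2 * pi * (N - vcomp l * (1 + T)))) + norm (C l) * exp (- (2 * pi * (N + vcomp l * (1 + T))))"
    by (simp add: distrib_left exp_add[symmetric] mult.assoc) (simp add: algebra_simps)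
  also have "N - vcomp l * (1 + T) = bf G l l / 2 * h + bf G l (vproj y - ((1 + T) / bf G v v) *\<^sub>R v)"
    using vv_pos by (simp add: N_def bf_linear bf_vproj_swap vcomp_def)
  also have "N + vcomp l * (1 + T) = bf G l l / 2 * h + bf G l (vproj y + ((1 + T) / bf G v v) *\<^sub>R v)"
    using vv_pos by (simp add: N_def bf_linear bf_vproj_swap vcomp_def)
  finally show ?thesis by (simp add: majorant_def y_def)
qed

lemma quot_term_summable: "Im \<tau> > 0 \<Longrightarrow> (\<lambda>l. quot_term l \<tau> z) summable_on UNIV"
proof -
  assume \<tau>: "Im \<tau> > 0"
  have "(\<lambda>l. norm (quot_term l \<tau> z)) summable_on UNIV"
    by (rule summable_on_comparison_test[OF summable_on_add[OF majorant_summable[OF \<tau>] majorant_summable[OF \<tau>]]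
          quot_term_bound[OF order_refl order_refl]]) auto
  then show ?thesis by (simp add: summable_on_iff_abs_summable_on_complex)
qed

text \<open>Averaging the expansion with the negative of its reflected version makes every single
  term a multiple of (v,z).\<close>

lemma phi_eq_quot:
  assumes \<tau>: "Im \<tau> > 0"
  shows "\<phi> \<tau> z = bf G (rvec v) z * quot \<tau> z"
proof -
  let ?w = "bf G (rvec v) z"
  have "((\<lambda>l. (1/2) * (C l * ee (of_real (bf G l l / 2) * \<tau> + bf G (rvec l) z) +
     - (C l * ee (of_real (bf G l l / 2) * \<tau> + bf G (rvec (vrefl l)) z)))) has_sum (1/2) * (\<phi> \<tau> z + - (- \<phi> \<tau> z))) UNIV"
    by (intro has_sum_cmult_right has_sum_add has_sum_uminusI expansion has_sum_vrefl \<tau>)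
  also have "(\<lambda>l. (1/2) * (C l * ee (of_real (bf G l l / 2) * \<tau> + bf G (rvec l) z) +
     - (C l * ee (of_real (bf G l l / 2) * \<tau> + bf G (rvec (vrefl l)) z)))) = (\<lambda>l. ?w * quot_term l \<tau> z)"
  proof
    fix l
    have 1: "bf G (rvec l) z = bf G (rvec (vproj l)) z + of_real (vcomp l) * ?w"
      by (subst decompose[of l]) (simp add: rvec_add rvec_scaleR bf_linear)
    have 2: "bf G (rvec (vrefl l)) z = bf G (rvec (vproj l)) z + - (of_real (vcomp l) * ?w)"
      by (simp add: vrefl_eq rvec_diff rvec_scaleR bf_linear)
    have "?w * quot_term l \<tau> z = C l * ee (of_real (bf G l l / 2) * \<tau> + bf G (rvec (vproj l)) z) * (?w * sinq (vcomp l) ?w)"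
      by (simp only: quot_term_def mult_ac)
    also have "\<dots> = (1/2) * (C l * ee (of_real (bf G l l / 2) * \<tau> + bf G (rvec l) z) +
     - (C l * ee (of_real (bf G l l / 2) * \<tau> + bf G (rvec (vrefl l)) z)))"
      unfolding sinq_mult 1 2 ee_add by (simp add: field_simps)
    finally show "(1/2) * (C l * ee (of_real (bf G l l / 2) * \<tau> + bf G (rvec l) z) +
     - (C l * ee (of_real (bf G l l / 2) * \<tau> + bf G (rvec (vrefl l)) z))) = ?w * quot_term l \<tau> z" by simp
  qed
  finally have "((\<lambda>l. ?w * quot_term l \<tau> z) has_sum \<phi> \<tau> z) UNIV" by simp
  moreover have "((\<lambda>l. ?w * quot_term l \<tau> z) has_sum ?w * quot \<tau> z) UNIV"
    unfolding quot_def by (intro has_sum_cmult_right has_sum_infsum quot_term_summable \<tau>)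
  ultimately show ?thesis using has_sum_unique by blast
qed

lemma bf_rvec_update:
  "bf G (rvec l) (\<chi> j. if j = i then w else z$j) = bf G (rvec l) z + of_real (gvec G l $ i) * (w - z$i)"
proof -
  have eq: "(\<chi> j. if j = i then w else z$j) = z + (w - z$i) *s axis i 1"
    by (auto simp: vec_eq_iff axis_def)
  have ax: "bf G (rvec l) (axis i 1) = of_real (gvec G l $ i)"
  proof -
    have "axis i 1 = rvec (axis i 1)" by (simp add: rvec_def axis_def vec_eq_iff)
    then have "bf G (rvec l) (axis i 1) = of_real (bf G l (axis i 1))" by (simp add: bf_rvec)
    then show ?thesis by (simp add: bf_gvec inner_axis)
  qed
  show ?thesis unfolding eq bf_add_right bf_smult_right ax by simp
qed

lemma quot_holomorphic: "holo_HC quot"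
  unfolding holo_HC_def
proof (intro conjI allI ballI)
  fix z
  show "(\<lambda>t. quot t z) holomorphic_on upper_half_plane"
    unfolding quot_def
  proof (rule holomorphic_on_infsum)
    show "open upper_half_plane" by (simp add: upper_half_plane_def open_halfspace_Im_gt)
    show "(\<lambda>t. quot_term l t z) holomorphic_on upper_half_plane" for l
      unfolding quot_term_def by (intro holomorphic_intros)
    fix \<tau> assume "\<tau> \<in> upper_half_plane"
    then have \<tau>: "Im \<tau> > 0" by (simp add: upper_half_plane_def)
    have Im_ge: "Im u \<ge> Im \<tau> / 2" if "u \<in> cball \<tau> (Im \<tau> / 2)" for u
      using that abs_Im_le_cmod[of "\<tau> - u"] by (auto simp: dist_norm)
    let ?u = "((1 + norm (bf G (rvec v) z)) / bf G v v) *\<^sub>R v"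
    let ?M = "\<lambda>l. majorant (Im \<tau> / 2) (vproj (\<chi> i. Im (z$i)) + ?u) l + majorant (Im \<tau> / 2) (vproj (\<chi> i. Im (z$i)) - ?u) l"
    show "\<exists>d>0. cball \<tau> d \<subseteq> upper_half_plane \<and> (\<exists>M. M summable_on UNIV \<and> (\<forall>l\<in>UNIV. \<forall>u\<in>cball \<tau> d. norm (quot_term l u z) \<le> M l))"
    proof (intro exI[of _ "Im \<tau> / 2"] conjI)
      show "cball \<tau> (Im \<tau> / 2) \<subseteq> upper_half_plane"
        using Im_ge \<tau> by (fastforce simp: upper_half_plane_def)
      show "\<exists>M. M summable_on UNIV \<and> (\<forall>l\<in>UNIV. \<forall>u\<in>cball \<tau> (Im \<tau> / 2). norm (quot_term l u z) \<le> M l)"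
      proof (intro exI conjI ballI)
        show "norm (quot_term l u z) \<le> ?M l" if "u \<in> cball \<tau> (Im \<tau> / 2)" for l u
          using quot_term_bound[OF Im_ge[OF that] order_refl] .
        show "?M summable_on UNIV"
          using \<tau> by (intro summable_on_add majorant_summable) auto
      qed
    qed (use \<tau> in auto)
  qed
next
  fix \<tau> :: complex and z :: "complex^'n" and i :: 'n assume "\<tau> \<in> upper_half_plane"
  then have \<tau>: "Im \<tau> > 0" by (simp add: upper_half_plane_def)
  let ?z = "\<lambda>w. (\<chi> j. if j = i then w else z$j) :: complex^'n"
  show "(\<lambda>w. quot \<tau> (?z w)) holomorphic_on UNIV"
    unfolding quot_def
  proof (rule holomorphic_on_infsum)
    show "(\<lambda>w. quot_term l \<tau> (?z w)) holomorphic_on UNIV" for l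
      unfolding quot_term_def bf_rvec_update
      by (intro holomorphic_intros holomorphic_on_compose_gen[OF _ sinq_holomorphic, unfolded o_def]) auto
    fix w0 :: complex
    \<comment> \<open>On the unit disc around \<open>w0\<close> the value of (v,z) changes by at
      most the modulus of its slope \<open>gvec G v $ i\<close>.\<close>
    define T where "T = norm (bf G (rvec v) (?z w0)) + \<bar>gvec G v $ i\<bar>"
    define y where "y = (\<chi> j. Im (?z w0 $ j))"
    define e :: "real^'n" where "e = axis i 1"
    \<comment> \<open>Four majorants: the two signs from \<open>sinq_bound\<close> times the two
      extreme imaginary shifts of the varying coordinate.\<close>
    define B where "B = (\<lambda>l. majorant (Im \<tau>) (vproj (y + e) + ((1 + T) / bf G v v) *\<^sub>R v) l + majorant (Im \<tau>) (vproj (y - e) + ((1 + T) / bf G v v) *\<^sub>R v) l +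
      (majorant (Im \<tau>) (vproj (y + e) - ((1 + T) / bf G v v) *\<^sub>R v) l + majorant (Im \<tau>) (vproj (y - e) - ((1 + T) / bf G v v) *\<^sub>R v) l))"
    have "norm (quot_term l \<tau> (?z w)) \<le> B l" if w: "w \<in> cball w0 1" for l w
    proof -
      define s where "s = Im (w - w0)"
      have s: "\<bar>s\<bar> \<le> 1" using w abs_Im_le_cmod[of "w - w0"] by (simp add: s_def dist_norm norm_minus_commute)
      have "bf G (rvec v) (?z w) = bf G (rvec v) (?z w0) + of_real (gvec G v $ i) * (w - w0)"
        unfolding bf_rvec_update by (simp add: algebra_simps)
      then have "norm (bf G (rvec v) (?z w)) \<le> norm (bf G (rvec v) (?z w0)) + norm (of_real (gvec G v $ i) * (w - w0))"
        by (simp add: norm_triangle_ineq)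
      also have "norm (of_real (gvec G v $ i) * (w - w0)) \<le> \<bar>gvec G v $ i\<bar> * 1"
        unfolding norm_mult norm_of_real using w by (intro mult_left_mono) (auto simp: dist_norm norm_minus_commute)
      finally have T: "norm (bf G (rvec v) (?z w)) \<le> T" by (simp add: T_def)
      have Imz: "(\<chi> j. Im (?z w $ j)) = y + s *\<^sub>R e"
        by (auto simp: y_def e_def s_def vec_eq_iff axis_def)
      \<comment> \<open>The exponent is affine in s, so on [-1, 1] it is bounded by its value at one
        of the end points; this frees the dominating series from w.\<close>
      have maj: "majorant (Im \<tau>) (vproj (y + s *\<^sub>R e) + u) l \<le> majorant (Im \<tau>) (vproj (y + e) + u) l + majorant (Im \<tau>) (vproj (y - e) + u) l" for u
      proof -
        define X where "X = bf G l l / 2 * Im \<tau> + bf G l u + bf G (vproj l) y"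
        define Y where "Y = bf G (vproj l) e"
        have m: "majorant (Im \<tau>) (vproj (y + r *\<^sub>R e) + u) l = norm (C l) * exp (- (2 * pi * (X + r * Y)))" for r
          by (simp add: majorant_def X_def Y_def bf_linear bf_vproj_swap algebra_simps)
        have "- (s * Y) \<le> \<bar>Y\<bar>"
          using mult_mono[OF s order_refl, of "\<bar>Y\<bar>"] abs_mult[of s Y] by linarith
        then consider "- (X + s * Y) \<le> - (X + 1 * Y)" | "- (X + s * Y) \<le> - (X + (-1) * Y)" by linarith
        then have "exp (- (2 * pi * (X + s * Y))) \<le> exp (- (2 * pi * (X + 1 * Y))) + exp (- (2 * pi * (X + (-1) * Y)))"
        proof cases
          case 1
          then have "exp (- (2 * pi * (X + s * Y))) \<le> exp (- (2 * pi * (X + 1 * Y)))" by simp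
          then show ?thesis by (rule order_trans) simp
        next
          case 2
          then have "exp (- (2 * pi * (X + s * Y))) \<le> exp (- (2 * pi * (X + (-1) * Y)))" by simp
          then show ?thesis by (rule order_trans) simp
        qed
        then have "norm (C l) * exp (- (2 * pi * (X + s * Y))) \<le> norm (C l) * (exp (- (2 * pi * (X + 1 * Y))) + exp (- (2 * pi * (X + (-1) * Y))))"
          by (intro mult_left_mono) auto
        then have "majorant (Im \<tau>) (vproj (y + s *\<^sub>R e) + u) l \<le>
            majorant (Im \<tau>) (vproj (y + 1 *\<^sub>R e) + u) l + majorant (Im \<tau>) (vproj (y + (-1) *\<^sub>R e) + u) l"
          unfolding m by (simp only: distrib_left)
        then show ?thesis by simp
      qed
      show ?thesis
        using quot_term_bound[OF order_refl[of "Im \<tau>"] T, of l] maj[of "((1 + T) / bf G v v) *\<^sub>R v"] maj[of "- (((1 + T) / bf G v v) *\<^sub>R v)"]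
        unfolding Imz B_def by simp
    qed
    moreover have "B summable_on UNIV"
      unfolding B_def by (intro summable_on_add majorant_summable \<tau>)
    ultimately show "\<exists>d>0. cball w0 d \<subseteq> UNIV \<and> (\<exists>M. M summable_on UNIV \<and> (\<forall>l\<in>UNIV. \<forall>w\<in>cball w0 d. norm (quot_term l \<tau> (?z w)) \<le> M l))"
      by (intro exI[of _ 1]) auto
  qed auto
qed

text \<open>Only separate holomorphy of the cofactor \<open>g\<close> is available, so the hyperplane is approached along
  a coordinate axis on which \<open>(v, z)\<close> is not constant.\<close>

lemma not_divisible_twice:
  assumes m: "m \<ge> 2"
  shows "\<not> divisible_by_hyperplane G v m \<phi>"
proof
  assume "divisible_by_hyperplane G v m \<phi>"
  then obtain g where g: "holo_HC g" and \<phi>_g: "\<And>\<tau> z. Im \<tau> > 0 \<Longrightarrow> \<phi> \<tau> z = bf G (rvec v) z ^ m * g \<tau> z"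
    by (auto simp: divisible_by_hyperplane_def upper_half_plane_def)
  obtain i where i: "gvec G v $ i \<noteq> 0"
    using vv_pos by (metis bf_gvec inner_zero_left less_irrefl vec_eq_iff zero_index)
  have quot_zero: "quot \<tau> z = 0" if \<tau>: "Im \<tau> > 0" and z: "bf G (rvec v) z = 0" for \<tau> z
  proof -
    let ?z = "\<lambda>w. (\<chi> j. if j = i then w else z$j) :: complex^'n"
    let ?L = "\<lambda>w. of_real (gvec G v $ i) * (w - z$i)"
    have L: "bf G (rvec v) (?z w) = ?L w" for w by (simp add: bf_rvec_update z)
    have \<tau>': "\<tau> \<in> upper_half_plane" using \<tau> by (simp add: upper_half_plane_def)
    have "(\<lambda>w. quot \<tau> (?z w)) holomorphic_on UNIV" "(\<lambda>w. g \<tau> (?z w)) holomorphic_on UNIV"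
      using quot_holomorphic g \<tau>' unfolding holo_HC_def by blast+
    then have cont: "isCont (\<lambda>w. quot \<tau> (?z w)) (z$i)" "isCont (\<lambda>w. g \<tau> (?z w)) (z$i)"
      using holomorphic_on_imp_continuous_on continuous_on_eq_continuous_at[OF open_UNIV] by blast+
    have lim1: "((\<lambda>w. quot \<tau> (?z w)) \<longlongrightarrow> quot \<tau> (?z (z$i))) (at (z$i))"
      using cont(1) unfolding isCont_def .
    have lim2: "((\<lambda>w. ?L w ^ (m - 1) * g \<tau> (?z w)) \<longlongrightarrow> ?L (z$i) ^ (m - 1) * g \<tau> (?z (z$i))) (at (z$i))"
      using cont(2) unfolding isCont_def
      by (intro tendsto_mult[of "\<lambda>w. ?L w ^ (m - 1)"] tendsto_power tendsto_diff tendsto_mult[of "\<lambda>w. of_real _"] tendsto_const tendsto_ident_at)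
    have "quot \<tau> (?z w) = ?L w ^ (m - 1) * g \<tau> (?z w)" if "w \<noteq> z$i" for w
    proof -
      have "?L w * quot \<tau> (?z w) = \<phi> \<tau> (?z w)"
        using phi_eq_quot[OF \<tau>, of "?z w"] unfolding L by (rule sym)
      also have "\<dots> = ?L w ^ m * g \<tau> (?z w)"
        using \<phi>_g[OF \<tau>, of "?z w"] unfolding L .
      also have "?L w ^ m = ?L w * ?L w ^ (m - 1)"
        using m by (cases m) auto
      finally have "?L w * quot \<tau> (?z w) = ?L w * (?L w ^ (m - 1) * g \<tau> (?z w))"
        by (simp only: mult.assoc)
      moreover have "?L w \<noteq> 0" using i that by simp
      ultimately show ?thesis by (rule mult_left_cancel[THEN iffD1, rotated])
    qed
    then have "eventually (\<lambda>w. quot \<tau> (?z w) = ?L w ^ (m - 1) * g \<tau> (?z w)) (at (z$i))"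
      by (auto simp: eventually_at_filter)
    from tendsto_cong[OF this] lim1 lim2 have "quot \<tau> (?z (z$i)) = ?L (z$i) ^ (m - 1) * g \<tau> (?z (z$i))"
      using tendsto_unique[OF trivial_limit_at] by blast
    also have "\<dots> = 0" using m by simp
    also have "?z (z$i) = z" by (simp add: vec_eq_iff)
    finally show ?thesis .
  qed
  \<comment> \<open>As \<open>sinq (vcomp l) 0\<close> is 2 \<pi> i \<open>vcomp l\<close>, these
    are the coefficients of the quotient on the hyperplane. \<open>C\<close> and
    \<open>vcomp\<close> both change sign under \<open>vrefl\<close>, so
    \<open>b l + b (vrefl l)\<close> is 2 \<open>b l\<close>.\<close>
  define b where "b = (\<lambda>l. C l * (2 * pi * \<i> * of_real (vcomp l)))"
  have b_sum: "((\<lambda>l. b l * ee (of_real (bf G l l / 2) * (\<i> + of_real a) + of_real (bf G (vproj l) y))) has_sum 0) UNIV" for a y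
  proof -
    have \<tau>: "Im (\<i> + complex_of_real a) > 0" by simp
    have "((\<lambda>l. quot_term l (\<i> + of_real a) (rvec (vproj y))) has_sum quot (\<i> + of_real a) (rvec (vproj y))) UNIV"
      unfolding quot_def by (intro has_sum_infsum quot_term_summable \<tau>)
    moreover have "quot_term l (\<i> + of_real a) (rvec (vproj y)) =
        b l * ee (of_real (bf G l l / 2) * (\<i> + of_real a) + of_real (bf G (vproj l) y))" for l
    proof -
      have "bf G (vproj l) (vproj y) = bf G (vproj l) y"
        using bf_vproj_swap[of "vproj l" y] by (simp add: vproj_def[of "vproj l"] vcomp_def)
      then show ?thesis by (simp add: quot_term_def b_def sinq_def bf_rvec)
    qed
    ultimately show ?thesis using quot_zero[OF \<tau>, of "rvec (vproj y)"] by simp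
  qed
  have "C l = 0" for l
  proof (cases "vcomp l = 0")
    case True then show ?thesis by (rule C_orth)
  next
    case False
    have "b l + b (vrefl l) = 0" by (rule coefficient_pairing(2)[OF b_sum False])
    then show ?thesis using False by (simp add: b_def C_vrefl)
  qed
  then have "\<phi> \<tau> z = 0" if "Im \<tau> > 0" for \<tau> z
    by (intro has_sum_unique[OF expansion[OF that, of z]] has_sum_0) simp
  then show False using nonzero by blast
qed

lemma multiplicity_one: "hyperplane_multiplicity G v \<phi> = 1"
  unfolding hyperplane_multiplicity_def
proof (rule Greatest_equality)
  show "divisible_by_hyperplane G v 1 \<phi>"
    unfolding divisible_by_hyperplane_def
    using quot_holomorphic phi_eq_quot by (auto simp: upper_half_plane_def)
  show "m \<le> 1" if "divisible_by_hyperplane G v m \<phi>" for m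
    using not_divisible_twice that by (metis One_nat_def Suc_1 not_less_eq_eq)
qed

end

theorem theorem2p1:
  fixes G :: "int^'n^'n" and D :: int and \<phi> :: "complex \<Rightarrow> complex^'n \<Rightarrow> complex"
    and v :: "real^'n"
  assumes "int_pos_def_lattice G"
    and "singular_jacobi_form G D \<phi>"
    and "\<exists>\<tau>\<in>upper_half_plane. \<exists>z. \<phi> \<tau> z \<noteq> 0"
    and "v \<in> dual_lattice G" and "v \<noteq> 0"
    and "\<forall>\<tau>\<in>upper_half_plane. \<forall>z. bf G (rvec v) z = 0 \<longrightarrow> \<phi> \<tau> z = 0"
  shows "hyperplane_multiplicity G v \<phi> = 1 \<and>
         (\<forall>\<tau>\<in>upper_half_plane. \<forall>z. \<phi> \<tau> (reflection G v z) = - \<phi> \<tau> z)"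
proof -
  have H: "\<tau> \<in> upper_half_plane \<longleftrightarrow> Im \<tau> > 0" for \<tau>
    by (simp add: upper_half_plane_def)
  note jf = assms(2)[unfolded singular_jacobi_form_def, THEN conjunct2, THEN conjunct1]
    assms(2)[unfolded singular_jacobi_form_def, THEN conjunct2, THEN conjunct2, THEN conjunct1]
    assms(2)[unfolded singular_jacobi_form_def, THEN conjunct2, THEN conjunct2, THEN conjunct2]
  have modular: "\<phi> ((of_int a * \<tau> + of_int b) / (of_int c * \<tau> + of_int d)) (\<chi> i. z$i / (of_int c * \<tau> + of_int d)) =
      v_eta a b c d powi D * csqrt (of_int c * \<tau> + of_int d) ^ CARD('n) *
      exp (pi * \<i> * of_int c * bf G z z / (of_int c * \<tau> + of_int d)) * \<phi> \<tau> z"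
    if "a * d - b * c = 1" "Im \<tau> > 0" for a b c d \<tau> z
    using jf(1)[rule_format, OF that(1) H[THEN iffD2, OF that(2)]] .
  have elliptic: "\<phi> \<tau> (\<chi> i. z$i + \<tau> * of_int (x$i) + of_int (y$i)) =
      (-1) ^ nat (bf G (ivec x) (ivec x) + bf G (ivec y) (ivec y)) *
      exp (- pi * \<i> * (bf G (ivec x) (ivec x) * \<tau> + 2 * bf G (ivec x) z)) * \<phi> \<tau> z"
    if "Im \<tau> > 0" for x y \<tau> z
    using jf(2)[rule_format, OF H[THEN iffD2, OF that]] .
  obtain f where f: "\<forall>\<tau>\<in>upper_half_plane. \<forall>z.
      ((\<lambda>(m, l). f m l * exp (2 * pi * \<i> * of_real m * \<tau>) * exp (2 * pi * \<i> * bf G (rvec l) z)) has_sum \<phi> \<tau> z) (fourier_index G D)"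
    using jf(3) by (rule exE)
  \<comment> \<open>The inversion is the matrix with a = d = 0, b = -1, c = 1, which gives the value
    of \<open>\<epsilon>\<close>.\<close>
  interpret singular_form G D \<phi> f "v_eta 0 (- 1) 1 0 powi D"
  proof
    show "int_pos_def_lattice G" by fact
    show "((\<lambda>(m, l). f m l * ee (of_real m * \<tau>) * ee (bf G (rvec l) z)) has_sum \<phi> \<tau> z) (fourier_index G D)"
      if "Im \<tau> > 0" for \<tau> z
      using f[rule_format, OF H[THEN iffD2, OF that], of z] by (simp add: ee_def mult.assoc)
    show "\<phi> \<tau> (z + \<tau> *s ivec p) = (-1) ^ nat (bf G p p) * ee (- (of_int (bf G p p) * \<tau> / 2 + bf G (ivec p) z)) * \<phi> \<tau> z"
      if "Im \<tau> > 0" for \<tau> z p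
    proof -
      have "z + \<tau> *s ivec p = (\<chi> i. z$i + \<tau> * of_int (p$i) + of_int (0$i))"
        by (simp add: vec_eq_iff ivec_def)
      moreover have "ee (- (of_int (bf G p p) * \<tau> / 2 + bf G (ivec p) z)) =
          exp (- pi * \<i> * (bf G (ivec p) (ivec p) * \<tau> + 2 * bf G (ivec p) z))"
        unfolding ee_def bf_ivec by (rule arg_cong[of _ _ exp]) (simp add: algebra_simps)
      ultimately show ?thesis using elliptic[OF that, of z p 0] by simp
    qed
    show "\<phi> (- 1 / \<tau>) ((1 / \<tau>) *s z) = v_eta 0 (- 1) 1 0 powi D * csqrt \<tau> ^ CARD('n) * ee (bf G z z / (2 * \<tau>)) * \<phi> \<tau> z"
      if "Im \<tau> > 0" for \<tau> z
    proof -
      have "(1 / \<tau>) *s z = (\<chi> i. z$i / \<tau>)" by (simp add: vec_eq_iff)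
      moreover have "ee (bf G z z / (2 * \<tau>)) = exp (pi * \<i> * bf G z z / \<tau>)"
        unfolding ee_def by (rule arg_cong[of _ _ exp]) (simp add: field_simps)
      ultimately show ?thesis using modular[of 0 0 "- 1" 1 \<tau> z] that by simp
    qed
    show "\<exists>\<tau> z. Im \<tau> > 0 \<and> \<phi> \<tau> z \<noteq> 0" using assms(3) H by blast
  qed
  obtain c where c: "\<And>\<tau> z. Im \<tau> > 0 \<Longrightarrow>
     ((\<lambda>l. c l * ee (of_real (bf G l l / 2) * \<tau> + bf G (rvec l) z)) has_sum \<phi> \<tau> z) (shadow G)"
    using constant_theta_expansion by blast
  interpret theta_series G "\<lambda>l. if l \<in> shadow G then c l else 0" \<phi> v
  proof
    show "((\<lambda>l. (if l \<in> shadow G then c l else 0) * ee (of_real (bf G l l / 2) * \<tau> + bf G (rvec l) z)) has_sum \<phi> \<tau> z) UNIV"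
      if "Im \<tau> > 0" for \<tau> z
      using c[OF that, of z] by (rule has_sum_cong_neutral[THEN iffD1, rotated -1]) auto
  qed (use assms(3,5,6) H in auto)
  show ?thesis using multiplicity_one reflection_antisymmetric H by blast
qed

end
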